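(* Let $(X,d,A)$ be a metric pair with $A$ not isolated, let $Y$ be a topological space that contains a nontrivial path, and let $p\in[1,\infty]$. Then the function spaces $C((D(X,A),W_p),Y)$ and $C((\overline{D}_p(X,A),W_p),Y)$, equipped with the compact-open topology, are not metrizable.
   Context: A metric on $X$ is a map $d:X\times X\to[0,\infty]$ with $d(x,x)=0$, symmetry and the triangle inequality (infinite distances allowed, $d(x,y)=0$ need not imply $x=y$); a metric pair $(X,d,A)$ is such a space with a closed subset $A$. Write $d(x,A)=\inf_{a\in A}d(x,a)$, $A^\delta=\{x:d(x,A)<\delta\}$ for $\delta\in(0,\infty]$; $A$ is isolated if $A^\delta=A$ for some $\delta>0$. $\overline{D}(X,A)$ is the set of countable formal sums $\hat\alpha=\sum_{i\in I}x_i$ of points of $X\setminus A$ (repetitions allowed); $D(X,A)$ the finite ones; $0$ the empty sum. A matching of $\hat\alpha=\sum_{i\in I}x_i$, $\hat\beta=\sum_{j\in J}y_j$ is a formal sum $\sum_{k\in K}(x_k,y_{\varphi(k)})+\sum_{i\in I\setminus K}(x_i,z_i)+\sum_{j\in J\setminus\varphi(K)}(w_j,y_j)$ with $K\subset I$, $\varphi$ injective, $z_i,w_j\in A$; its $p$-cost is the $\ell^p$ norm (sup norm if $p=\infty$) of the distances of paired points; $W_p$ is the infimum of $p$-costs. $u_\delta(\alpha)$, $\ell_\delta(\alpha)$ are the restrictions of $\hat\alpha$ to $X\setminus A^\delta$ and to $A^\delta\setminus A$. For $p<\infty$, $\overline{D}_p(X,A)=\{\alpha: |u_\infty(\alpha)|<\infty,\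 W_p(\ell_\infty(\alpha),0)<\infty\}$; $\overline{D}_\infty(X,A)=\{\alpha:|u_\delta(\alpha)|<\infty\ \forall\delta>0\}$. $C(Z,Y)$ denotes the space of continuous maps $Z\to Y$; a nontrivial path is a non-constant continuous map $[0,1]\to Y$. *)

theory Defs
  imports "HOL-Analysis.Analysis"
begin

definition ext_metric :: "('a \<Rightarrow> 'a \<Rightarrow> ennreal) \<Rightarrow> bool" where
  "ext_metric d \<longleftrightarrow> (\<forall>x. d x x = 0) \<and> (\<forall>x y. d x y = d y x)
     \<and> (\<forall>x y z. d x z \<le> d x y + d y z)"

definition ext_metric_topology :: "'a set \<Rightarrow> ('a \<Rightarrow> 'a \<Rightarrow> ennreal) \<Rightarrow> 'a topology" where
  "ext_metric_topology S \<rho> = topology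
     (\<lambda>U. U \<subseteq> S \<and> (\<forall>x\<in>U. \<exists>r>0. {y\<in>S. \<rho> x y < r} \<subseteq> U))"

definition setdist_e :: "('a \<Rightarrow> 'a \<Rightarrow> ennreal) \<Rightarrow> 'a \<Rightarrow> 'a set \<Rightarrow> ennreal" where
  "setdist_e d x A = (INF a\<in>A. d x a)"

definition thicken :: "('a \<Rightarrow> 'a \<Rightarrow> ennreal) \<Rightarrow> 'a set \<Rightarrow> ennreal \<Rightarrow> 'a set" where
  "thicken d A \<delta> = {x. setdist_e d x A < \<delta>}"

definition metric_pair :: "('a \<Rightarrow> 'a \<Rightarrow> ennreal) \<Rightarrow> 'a set \<Rightarrow> bool" where
  "metric_pair d A \<longleftrightarrow> ext_metric d \<and> closedin (ext_metric_topology UNIV d) A"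

definition isolated_subset :: "('a \<Rightarrow> 'a \<Rightarrow> ennreal) \<Rightarrow> 'a set \<Rightarrow> bool" where
  "isolated_subset d A \<longleftrightarrow> (\<exists>\<delta>>0. thicken d A \<delta> = A)"

definition esum :: "('i \<Rightarrow> 'b::{complete_lattice, comm_monoid_add}) \<Rightarrow> 'i set \<Rightarrow> 'b" where
  "esum f S = (SUP F\<in>{F. finite F \<and> F \<subseteq> S}. sum f F)"

definition ecard :: "'i set \<Rightarrow> enat" where
  "ecard S = (if finite S then enat (card S) else \<infinity>)"

text \<open>A persistence diagram (countable formal sum of points of X - A, with repetitions)
  is represented by its multiplicity function; multiplicity \<infinity> means countably many copies.\<close>

type_synonym 'a diag = "'a \<Rightarrow> enat"

definition Dbar :: "'a set \<Rightarrow> 'a diag set" where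
  "Dbar A = {\<alpha>. countable {x. \<alpha> x \<noteq> 0} \<and> (\<forall>x\<in>A. \<alpha> x = 0)}"

definition Dfin :: "'a set \<Rightarrow> 'a diag set" where
  "Dfin A = {\<alpha>\<in>Dbar A. finite {x. \<alpha> x \<noteq> 0} \<and> (\<forall>x. \<alpha> x \<noteq> \<infinity>)}"

definition zero_diag :: "'a diag" where
  "zero_diag = (\<lambda>_. 0)"

definition restr :: "'a diag \<Rightarrow> 'a set \<Rightarrow> 'a diag" where
  "restr \<alpha> S = (\<lambda>x. if x \<in> S then \<alpha> x else 0)"

definition dcard :: "'a diag \<Rightarrow> enat" where
  "dcard \<alpha> = esum \<alpha> UNIV"

definition upper :: "('a \<Rightarrow> 'a \<Rightarrow> ennreal) \<Rightarrow> 'a set \<Rightarrow> ennreal \<Rightarrow> 'a diag \<Rightarrow> 'a diag" where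
  "upper d A \<delta> \<alpha> = restr \<alpha> (- thicken d A \<delta>)"

definition lower :: "('a \<Rightarrow> 'a \<Rightarrow> ennreal) \<Rightarrow> 'a set \<Rightarrow> ennreal \<Rightarrow> 'a diag \<Rightarrow> 'a diag" where
  "lower d A \<delta> \<alpha> = restr \<alpha> (thicken d A \<delta> - A)"

text \<open>An indexed enumeration (I, x) of a diagram (countable index sets are subsets of nat).\<close>
definition represents :: "'a diag \<Rightarrow> nat set \<Rightarrow> (nat \<Rightarrow> 'a) \<Rightarrow> bool" where
  "represents \<alpha> I x \<longleftrightarrow> (\<forall>a. ecard {i\<in>I. x i = a} = \<alpha> a)"

definition epowr :: "ennreal \<Rightarrow> real \<Rightarrow> ennreal" where
  "epowr t q = (if t = \<infinity> then \<infinity> else ennreal (enn2real t powr q))"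

definition matching_cost ::
  "('a \<Rightarrow> 'a \<Rightarrow> ennreal) \<Rightarrow> ennreal \<Rightarrow> nat set \<Rightarrow> (nat \<Rightarrow> 'a) \<Rightarrow> nat set \<Rightarrow> (nat \<Rightarrow> 'a)
    \<Rightarrow> nat set \<Rightarrow> (nat \<Rightarrow> nat) \<Rightarrow> (nat \<Rightarrow> 'a) \<Rightarrow> (nat \<Rightarrow> 'a) \<Rightarrow> ennreal" where
  "matching_cost d p I x J y K \<phi> z w =
    (if p = \<infinity> then
       sup (sup (SUP k\<in>K. d (x k) (y (\<phi> k))) (SUP i\<in>I - K. d (x i) (z i)))
           (SUP j\<in>J - \<phi> ` K. d (w j) (y j))
     else
       epowr (esum (\<lambda>k. epowr (d (x k) (y (\<phi> k))) (enn2real p)) K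
            + esum (\<lambda>i. epowr (d (x i) (z i)) (enn2real p)) (I - K)
            + esum (\<lambda>j. epowr (d (w j) (y j)) (enn2real p)) (J - \<phi> ` K))
         (1 / enn2real p))"

definition is_matching ::
  "'a set \<Rightarrow> 'a diag \<Rightarrow> 'a diag \<Rightarrow> nat set \<Rightarrow> (nat \<Rightarrow> 'a) \<Rightarrow> nat set \<Rightarrow> (nat \<Rightarrow> 'a)
    \<Rightarrow> nat set \<Rightarrow> (nat \<Rightarrow> nat) \<Rightarrow> (nat \<Rightarrow> 'a) \<Rightarrow> (nat \<Rightarrow> 'a) \<Rightarrow> bool" where
  "is_matching A \<alpha> \<beta> I x J y K \<phi> z w \<longleftrightarrow>
     represents \<alpha> I x \<and> represents \<beta> J y \<and> K \<subseteq> I \<and> inj_on \<phi> K \<and> \<phi> ` K \<subseteq> J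
     \<and> (\<forall>i\<in>I - K. z i \<in> A) \<and> (\<forall>j\<in>J - \<phi> ` K. w j \<in> A)"

definition Wp :: "('a \<Rightarrow> 'a \<Rightarrow> ennreal) \<Rightarrow> 'a set \<Rightarrow> ennreal \<Rightarrow> 'a diag \<Rightarrow> 'a diag \<Rightarrow> ennreal" where
  "Wp d A p \<alpha> \<beta> = (INF c \<in> {matching_cost d p I x J y K \<phi> z w | I x J y K \<phi> z w.
                         is_matching A \<alpha> \<beta> I x J y K \<phi> z w}. c)"

definition Dbar_p :: "('a \<Rightarrow> 'a \<Rightarrow> ennreal) \<Rightarrow> 'a set \<Rightarrow> ennreal \<Rightarrow> 'a diag set" where
  "Dbar_p d A p =
    (if p = \<infinity> then {\<alpha>\<in>Dbar A. \<forall>\<delta>>0. dcard (upper d A \<delta> \<alpha>) < \<infinity>}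
     else {\<alpha>\<in>Dbar A. dcard (upper d A \<infinity> \<alpha>) < \<infinity>
                      \<and> Wp d A p (lower d A \<infinity> \<alpha>) zero_diag < \<infinity>})"

definition cmaps :: "'z topology \<Rightarrow> 'y topology \<Rightarrow> ('z \<Rightarrow> 'y) set" where
  "cmaps Z Y = {f. continuous_map Z Y f \<and> f \<in> extensional (topspace Z)}"

definition compact_open :: "'z topology \<Rightarrow> 'y topology \<Rightarrow> ('z \<Rightarrow> 'y) topology" where
  "compact_open Z Y = topology_generated_by
     {{f\<in>cmaps Z Y. f ` K \<subseteq> U} | K U. compactin Z K \<and> openin Y U}"

definition nontrivial_path_in :: "'y topology \<Rightarrow> bool" where
  "nontrivial_path_in Y \<longleftrightarrow> (\<exists>g. pathin Y g \<and> \<not> (\<exists>c. \<forall>t\<in>{0..1}. g t = c))"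

end

theory Submission
  imports Defs
begin

text \<open>If the function space were metrizable, first countability at a constant map, together with a
  path separating two points of \<open>Y\<close>, would make some compact set contain all points near the empty
  diagram, up to separation by continuous real functions. Since \<open>A\<close> is not isolated, this fails:
  take many copies \<open>k x\<close> of one point \<open>x\<close> close to \<open>A\<close>. For \<open>p = \<infinity>\<close> a continuous sum over points at
  distance at least half that of \<open>x\<close> from \<open>A\<close> is bounded on compact sets and unbounded on \<open>k x\<close>.
  For \<open>p < \<infinity>\<close> the sum of \<open>min s (t - s)\<close> to the power \<open>p\<close>, with \<open>s\<close> the distance to \<open>A\<close>, is
  continuous and decreases to 0 with \<open>t\<close>, hence uniformly on compact sets by Dini, whereas \<open>k\<close> can
  be chosen to keep it bounded below on \<open>k x\<close>. All continuity statements are read off a single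
  matching, so the triangle inequality for \<open>W\<^sub>p\<close> is never needed.\<close>

section \<open>Topology of an extended metric and continuity of real functions on it\<close>

text \<open>Closure under intersections and unions holds for an arbitrary function \<rho>, the
  smaller of two radii serving an intersection. So this description of open sets applies to
  \<open>Wp\<close> before anything is known about it.\<close>

lemma openin_ext_metric_topology:
  "openin (ext_metric_topology S \<rho>) U \<longleftrightarrow>
     U \<subseteq> S \<and> (\<forall>x\<in>U. \<exists>r>0. {y\<in>S. \<rho> x y < r} \<subseteq> U)"
proof -
  have "istopology (\<lambda>U. U \<subseteq> S \<and> (\<forall>x\<in>U. \<exists>r>0. {y\<in>S. \<rho> x y < r} \<subseteq> U))"
    unfolding istopology_def
  proof (intro conjI allI impI)
    fix U V assume U: "U \<subseteq> S \<and> (\<forall>x\<in>U. \<exists>r>0. {y \<in> S. \<rho> x y < r} \<subseteq> U)"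
      and V: "V \<subseteq> S \<and> (\<forall>x\<in>V. \<exists>r>0. {y \<in> S. \<rho> x y < r} \<subseteq> V)"
    show "U \<inter> V \<subseteq> S" using U by blast
    show "\<forall>x\<in>U \<inter> V. \<exists>r>0. {y \<in> S. \<rho> x y < r} \<subseteq> U \<inter> V"
    proof
      fix x assume "x \<in> U \<inter> V"
      then obtain r s where "r > 0" "{y \<in> S. \<rho> x y < r} \<subseteq> U" "s > 0" "{y \<in> S. \<rho> x y < s} \<subseteq> V"
        using U V by fast
      then show "\<exists>r>0. {y \<in> S. \<rho> x y < r} \<subseteq> U \<inter> V"
        by (intro exI[of _ "min r s"]) auto
    qed
  next
    fix \<K> assume \<K>: "\<forall>U\<in>\<K>. U \<subseteq> S \<and> (\<forall>x\<in>U. \<exists>r>0. {y \<in> S. \<rho> x y < r} \<subseteq> U)"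
    then show "\<Union>\<K> \<subseteq> S" by blast
    show "\<forall>x\<in>\<Union>\<K>. \<exists>r>0. {y \<in> S. \<rho> x y < r} \<subseteq> \<Union>\<K>"
    proof
      fix x assume "x \<in> \<Union>\<K>"
      then obtain U where U: "U \<in> \<K>" "x \<in> U" by blast
      then obtain r where "r > 0" "{y \<in> S. \<rho> x y < r} \<subseteq> U" using \<K> by blast
      with U(1) show "\<exists>r>0. {y \<in> S. \<rho> x y < r} \<subseteq> \<Union>\<K>" by blast
    qed
  qed
  then show ?thesis
    by (simp add: ext_metric_topology_def topology_inverse')
qed

lemma topspace_ext_metric_topology [simp]: "topspace (ext_metric_topology S \<rho>) = S"
proof
  show "topspace (ext_metric_topology S \<rho>) \<subseteq> S"
    unfolding topspace_def by (auto simp: openin_ext_metric_topology)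
  have "openin (ext_metric_topology S \<rho>) S"
    unfolding openin_ext_metric_topology using zero_less_one by blast
  then show "S \<subseteq> topspace (ext_metric_topology S \<rho>)"
    by (rule openin_subset)
qed

text \<open>Openness is tested by one ball around each point of the set, so pointwise estimates
  suffice even though the balls themselves have not been shown to be open.\<close>

lemma continuous_map_ext_metric_topologyI:
  fixes F :: "'a \<Rightarrow> real"
  assumes "\<And>x e. \<lbrakk>x \<in> S; e > 0\<rbrakk> \<Longrightarrow> \<exists>r>0. \<forall>y\<in>S. \<rho> x y < r \<longrightarrow> \<bar>F y - F x\<bar> < e"
  shows "continuous_map (ext_metric_topology S \<rho>) euclideanreal F"
  unfolding continuous_map topspace_ext_metric_topology openin_ext_metric_topology
proof (intro conjI allI impI ballI)
  fix U x assume U: "openin euclideanreal U" and x: "x \<in> {x \<in> S. F x \<in> U}"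
  then obtain e where e: "e > 0" "ball (F x) e \<subseteq> U"
    by (auto simp: open_contains_ball)
  obtain r where "r > 0" "\<forall>y\<in>S. \<rho> x y < r \<longrightarrow> \<bar>F y - F x\<bar> < e"
    using assms x e(1) by blast
  with e(2) show "\<exists>r>0. {y \<in> S. \<rho> x y < r} \<subseteq> {x \<in> S. F x \<in> U}"
    by (intro exI[of _ r]) (auto simp: subset_iff dist_real_def abs_minus_commute)
qed auto

section \<open>The compact-open topology near constant maps and a criterion against
  metrizability\<close>

lemma topspace_compact_open [simp]: "topspace (compact_open Z Y) = cmaps Z Y"
proof -
  have "cmaps Z Y \<in> {{f\<in>cmaps Z Y. f ` K \<subseteq> U} | K U. compactin Z K \<and> openin Y U}"
    by (rule CollectI, rule exI[of _ "{}"], rule exI[of _ "{}"]) simp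
  moreover have "V \<subseteq> cmaps Z Y"
    if "V \<in> {{f\<in>cmaps Z Y. f ` K \<subseteq> U} | K U. compactin Z K \<and> openin Y U}" for V
    using that by (elim CollectE exE conjE) simp
  ultimately have "\<Union>{{f\<in>cmaps Z Y. f ` K \<subseteq> U} | K U. compactin Z K \<and> openin Y U} = cmaps Z Y"
    by (intro antisym Union_least Union_upper)
  then show ?thesis
    by (simp add: compact_open_def topology_generated_by_topspace)
qed

lemma const_in_cmaps:
  assumes "c \<in> topspace Y"
  shows "restrict (\<lambda>_. c) (topspace Z) \<in> cmaps Z Y"
proof -
  have "continuous_map Z Y (restrict (\<lambda>_. c) (topspace Z))"
    by (rule continuous_map_eq[of _ _ "\<lambda>_. c"]) (use assms in auto)
  then show ?thesis by (simp add: cmaps_def)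
qed

text \<open>Induction on how the open set is generated. Subbasic conditions for
  \<open>(K, U)\<close> and \<open>(L, V)\<close> follow from the single one for
  \<open>(K \<union> L, U \<inter> V)\<close>, and a constant map still satisfies that one because
  its only value lies in both \<open>U\<close> and \<open>V\<close>. This is special to constant
  maps.\<close>

lemma compact_open_nhd_const:
  assumes "openin (compact_open Z Y) W" "restrict (\<lambda>_. c) (topspace Z) \<in> W" "c \<in> topspace Y"
  shows "\<exists>K U. compactin Z K \<and> openin Y U \<and> c \<in> U \<and> {f\<in>cmaps Z Y. f ` K \<subseteq> U} \<subseteq> W"
proof -
  have "generate_topology_on {{f\<in>cmaps Z Y. f ` K \<subseteq> U} | K U. compactin Z K \<and> openin Y U} W"
    using assms(1) by (simp add: compact_open_def openin_topology_generated_by_iff)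
  then show ?thesis using assms(2)
  proof (induction rule: generate_topology_on.induct)
    case (Int a b)
    from Int.IH(1)[OF IntD1[OF Int.prems]] Int.IH(2)[OF IntD2[OF Int.prems]]
    obtain K U L V where KU: "compactin Z K" "openin Y U" "c \<in> U" "{f\<in>cmaps Z Y. f ` K \<subseteq> U} \<subseteq> a"
      and LV: "compactin Z L" "openin Y V" "c \<in> V" "{f\<in>cmaps Z Y. f ` L \<subseteq> V} \<subseteq> b"
      by (elim exE conjE)
    have "{f\<in>cmaps Z Y. f ` (K \<union> L) \<subseteq> U \<inter> V} \<subseteq> a \<inter> b"
      using KU(4) LV(4) by blast
    with KU(1-3) LV(1-3) show ?case
      by (intro exI[of _ "K \<union> L"] exI[of _ "U \<inter> V"]) (simp add: compactin_Un openin_Int)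
  next
    case (UN \<K>)
    then obtain k where k: "k \<in> \<K>" "restrict (\<lambda>_. c) (topspace Z) \<in> k" by (elim UnionE)
    obtain K U where "compactin Z K" "openin Y U" "c \<in> U" and sub: "{f\<in>cmaps Z Y. f ` K \<subseteq> U} \<subseteq> k"
      using UN.IH[OF k] by (elim exE conjE)
    moreover have "{f\<in>cmaps Z Y. f ` K \<subseteq> U} \<subseteq> \<Union>\<K>"
      using sub k(1) by (rule subset_trans[OF _ Union_upper])
    ultimately show ?case by (intro exI conjI)
  next
    case (Basis s)
    then obtain K U where KU: "compactin Z K" "openin Y U" and s: "s = {f\<in>cmaps Z Y. f ` K \<subseteq> U}"
      by (elim CollectE exE conjE)
    show ?case
    \<comment> \<open>For empty \<open>K\<close> the condition is vacuous and says nothing about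
      \<open>c \<in> U\<close>, so \<open>U\<close> is replaced by the whole space.\<close>
    proof (cases "K = {}")
      case True
      then show ?thesis
        unfolding s using assms(3) by (intro exI[of _ "{}"] exI[of _ "topspace Y"]) simp
    next
      case False
      then obtain k where k: "k \<in> K" by auto
      have "k \<in> topspace Z" using k KU(1) compactin_subset_topspace by blast
      moreover have "restrict (\<lambda>_. c) (topspace Z) ` K \<subseteq> U" using Basis.prems s by simp
      then have "restrict (\<lambda>_. c) (topspace Z) k \<in> U" using k by (rule subsetD[OF _ imageI])
      ultimately have "c \<in> U" by simp
      with KU show ?thesis by (intro exI[of _ K] exI[of _ U]) (simp add: s)
    qed
  qed simp
qed

text \<open>A path may be non-constant and yet closed. Cutting it off at a parameter
  \<open>t\<close> with \<open>g t \<noteq> g 0\<close> and rescaling makes the endpoints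
  differ.\<close>

lemma nontrivial_path_in_alt:
  assumes "nontrivial_path_in Y"
  obtains g where "continuous_map (top_of_set {0..1::real}) Y g" "g 0 \<noteq> g 1"
proof -
  obtain g where g: "continuous_map (top_of_set {0..1::real}) Y g" and nc: "\<not> (\<exists>c. \<forall>t\<in>{0..1}. g t = c)"
    using assms by (auto simp: nontrivial_path_in_def pathin_def)
  obtain t where t: "t \<in> {0..1}" "g t \<noteq> g 0" using nc by blast
  have "continuous_map (top_of_set {0..1}) (top_of_set {0..1}) (\<lambda>s. s * t)"
    using t(1) by (auto simp: continuous_map_in_subtopology mult_le_one intro!: continuous_intros)
  then have "continuous_map (top_of_set {0..1}) Y (g \<circ> (\<lambda>s. s * t))"
    using g by (rule continuous_map_compose)
  then show thesis by (rule that) (use t(2) in simp)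
qed

text \<open>First countability at a constant map forces countably many compact sets to swallow every
  compact set up to functional separation; the sequence \<open>z\<close> below converges to \<open>z0\<close> and
  escapes all of them.\<close>
lemma not_metrizable_compact_open:
  assumes Y: "nontrivial_path_in Y" and z0: "z0 \<in> S"
    and sep: "\<And>K \<epsilon>. \<lbrakk>compactin (ext_metric_topology S \<rho>) K; \<epsilon> > 0\<rbrakk> \<Longrightarrow>
      \<exists>z\<in>S. \<exists>F M. \<rho> z0 z < ennreal \<epsilon> \<and> continuous_map (ext_metric_topology S \<rho>) euclideanreal F
        \<and> (\<forall>k\<in>K. F k \<le> M) \<and> M < F z"
  shows "\<not> metrizable_space (compact_open (ext_metric_topology S \<rho>) Y)"
proof
  define Z where "Z = ext_metric_topology S \<rho>"
  have topZ [simp]: "topspace Z = S" by (simp add: Z_def)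
  assume "metrizable_space (compact_open (ext_metric_topology S \<rho>) Y)"
  then have fc: "first_countable (compact_open Z Y)" and haus: "Hausdorff_space (compact_open Z Y)"
    by (auto simp: Z_def metrizable_imp_first_countable metrizable_imp_Hausdorff_space)
  obtain g where g: "continuous_map (top_of_set {0..1::real}) Y g" and ne: "g 0 \<noteq> g 1"
    using nontrivial_path_in_alt[OF Y] .
  have gY: "g t \<in> topspace Y" if "t \<in> {0..1}" for t
    using g that by (auto simp: continuous_map_def)
  let ?c = "\<lambda>t. restrict (\<lambda>_. g t) (topspace Z)"
  have c: "?c t \<in> cmaps Z Y" if "t \<in> {0..1}" for t
    by (rule const_in_cmaps[OF gY[OF that]])
  have "?c 0 z0 \<noteq> ?c 1 z0" using ne z0 by simp
  then have neq: "?c 0 \<noteq> ?c 1" by metis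
  have c01: "?c 0 \<in> cmaps Z Y" "?c 1 \<in> cmaps Z Y" using c by auto
  \<comment> \<open>\<open>Y\<close> carries no separation axiom. Separating the two constant maps
    in the function space yields one: the open set \<open>V\<close> found below contains
    \<open>g 0\<close> but not \<open>g 1\<close>.\<close>
  then obtain W where W: "openin (compact_open Z Y) W" "?c 0 \<in> W" "?c 1 \<notin> W"
    using haus c01 neq unfolding Hausdorff_space_def topspace_compact_open disjnt_iff by metis
  obtain K V where V: "compactin Z K" "openin Y V" "g 0 \<in> V" "{f\<in>cmaps Z Y. f ` K \<subseteq> V} \<subseteq> W"
    using compact_open_nhd_const[OF W(1,2)] gY by auto
  have "\<not> ?c 1 ` K \<subseteq> V" using V(4) W(3) c01(2) by blast
  then have V1: "g 1 \<notin> V" using compactin_subset_topspace[OF V(1)] by (auto simp: image_subset_iff)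

  obtain \<B> where \<B>: "countable \<B>" "\<And>B. B \<in> \<B> \<Longrightarrow> openin (compact_open Z Y) B"
    "\<And>U. openin (compact_open Z Y) U \<Longrightarrow> ?c 0 \<in> U \<Longrightarrow> \<exists>B\<in>\<B>. ?c 0 \<in> B \<and> B \<subseteq> U"
    using bspec[OF fc[unfolded first_countable_def topspace_compact_open] c01(1)] by (elim exE conjE) simp
  define \<C> where "\<C> = {B\<in>\<B>. ?c 0 \<in> B}"
  have "\<C> \<noteq> {}" "countable \<C>" using \<B>(1) \<B>(3)[OF W(1,2)] by (auto simp: \<C>_def)
  then have B: "range (from_nat_into \<C>) = \<C>"
    by (rule range_from_nat_into)
  define B where "B = from_nat_into \<C>"
  have B: "range B = \<C>" using B by (simp add: B_def)
  define P where "P n K U \<longleftrightarrow> compactin Z K \<and> openin Y U \<and> g 0 \<in> U \<and> {f\<in>cmaps Z Y. f ` K \<subseteq> U} \<subseteq> B n"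
    for n K U
  have "\<exists>K U. P n K U" for n
    unfolding P_def
  proof (rule compact_open_nhd_const)
    have "B n \<in> \<C>" using B by blast
    then show "openin (compact_open Z Y) (B n)" "?c 0 \<in> B n"
      using \<B>(2) by (simp_all add: \<C>_def)
  qed (rule gY, simp)
  then obtain C U where "\<And>n. P n (C n) (U n)" by metis
  then have CU: "\<And>n. compactin Z (C n)" "\<And>n. g 0 \<in> U n"
    "\<And>n. {f\<in>cmaps Z Y. f ` C n \<subseteq> U n} \<subseteq> B n"
    unfolding P_def by blast+
  \<comment> \<open>A diagonal choice: \<open>z n\<close> is within \<open>1 / Suc n\<close> of
    \<open>z0\<close>, and a continuous real function separates it from the compact set
    \<open>C n\<close> of the \<open>n\<close>-th basic neighbourhood.\<close>
  define Q where "Q n z F M \<longleftrightarrow> \<rho> z0 z < ennreal (inverse (real (Suc n))) \<and>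
      continuous_map Z euclideanreal F \<and> (\<forall>k\<in>C n. F k \<le> M) \<and> M < F z" for n z F and M :: real
  have "\<exists>z\<in>S. \<exists>F M. Q n z F M" for n
    unfolding Q_def Z_def by (rule sep) (use CU(1) in \<open>simp_all add: Z_def\<close>)
  then obtain z F M where z: "\<And>n. z n \<in> S" and "\<And>n. Q n (z n) (F n) (M n)"
    by metis
  then have z0z: "\<And>n. \<rho> z0 (z n) < ennreal (inverse (real (Suc n)))"
    and F: "\<And>n. continuous_map Z euclideanreal (F n)" "\<And>n k. k \<in> C n \<Longrightarrow> F n k \<le> M n"
      "\<And>n. M n < F n (z n)"
    unfolding Q_def by blast+
  have lim: "limitin Z z z0 sequentially"
    unfolding limitin_def
  proof (intro conjI allI impI)
    fix T assume T: "openin Z T \<and> z0 \<in> T"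
    then obtain r where r: "r > 0" "{y\<in>S. \<rho> z0 y < r} \<subseteq> T"
      unfolding Z_def openin_ext_metric_topology by blast
    have "(\<lambda>n. ennreal (inverse (real (Suc n)))) \<longlonglongrightarrow> ennreal 0"
      by (intro tendsto_ennrealI LIMSEQ_inverse_real_of_nat)
    then have "\<forall>\<^sub>F n in sequentially. ennreal (inverse (real (Suc n))) < r"
      using r(1) by (intro order_tendstoD(2)[of _ 0]) auto
    then show "\<forall>\<^sub>F n in sequentially. z n \<in> T"
      proof eventually_elim
      case (elim n)
      then have "\<rho> z0 (z n) < r" using z0z less_trans by blast
      then show ?case using r(2) z by blast
    qed
  qed (use z0 in simp)
  \<comment> \<open>The convergent sequence with its limit is itself an admissible compact set. Some
    basic neighbourhood \<open>B n\<close> must therefore force maps to send all of it into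
    \<open>V\<close>, merely by their behaviour on \<open>C n\<close>.\<close>
  have "compactin Z (insert z0 (range z))"
    using lim z by (intro compactin_sequence_with_limit) auto
  then have op: "openin (compact_open Z Y) {f\<in>cmaps Z Y. f ` insert z0 (range z) \<subseteq> V}"
    unfolding compact_open_def using V(2) by (intro topology_generated_by_Basis) blast
  have "?c 0 ` insert z0 (range z) \<subseteq> V"
    using V(3) z z0 by (simp add: image_subset_iff)
  then obtain b where "b \<in> \<C>" and b: "b \<subseteq> {f\<in>cmaps Z Y. f ` insert z0 (range z) \<subseteq> V}"
    using \<B>(3)[OF op] c01(1) unfolding \<C>_def by blast
  then obtain n where "B n = b"
    using B by (metis imageE)
  then have sub: "{f\<in>cmaps Z Y. f ` C n \<subseteq> U n} \<subseteq> {f\<in>cmaps Z Y. f ` insert z0 (range z) \<subseteq> V}"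
    using CU(3)[of n] b by (simp only: subset_trans)
  \<comment> \<open>Rescaled and clamped, \<open>F n\<close> vanishes on \<open>C n\<close> and
    equals 1 at \<open>z n\<close>. Followed by the path, it gives a map that is \<open>g 0\<close>
    on \<open>C n\<close> but takes the value \<open>g 1\<close>, outside \<open>V\<close>, at
    \<open>z n\<close>.\<close>
  define f where "f = (\<lambda>x. max 0 (min 1 ((F n x - M n) / (F n (z n) - M n))))"
  have "continuous_map Z euclideanreal f"
    unfolding f_def using F(1)[of n] F(3)[of n] by (intro continuous_intros) auto
  then have "continuous_map Z (top_of_set {0..1}) f"
    by (auto simp: continuous_map_in_subtopology f_def)
  then have "continuous_map Z Y (g \<circ> f)" using g by (rule continuous_map_compose)
  then have "continuous_map Z Y (restrict (g \<circ> f) S)"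
    by (rule continuous_map_eq) simp
  then have mem: "restrict (g \<circ> f) S \<in> cmaps Z Y" by (simp add: cmaps_def)
  have "f k = 0" if "k \<in> C n" for k
  proof -
    have "(F n k - M n) / (F n (z n) - M n) \<le> 0"
      using F(2)[OF that] F(3)[of n] by (simp add: divide_le_0_iff)
    then show ?thesis by (simp add: f_def)
  qed
  then have "restrict (g \<circ> f) S ` C n \<subseteq> U n"
    using compactin_subset_topspace[OF CU(1)[of n]] CU(2)[of n] by auto
  with mem have "restrict (g \<circ> f) S \<in> {f\<in>cmaps Z Y. f ` C n \<subseteq> U n}" by simp
  then have "restrict (g \<circ> f) S ` insert z0 (range z) \<subseteq> V" using sub by blast
  then have "restrict (g \<circ> f) S (z n) \<in> V" by blast
  moreover have "f (z n) = 1" using F(3)[of n] by (simp add: f_def)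
  ultimately show False using z[of n] V1 by simp
qed

section \<open>Sums over the entries of a diagram as integrals for the counting measure\<close>

lemma nn_integral_count_space_mono:
  assumes "A \<subseteq> B"
  shows "(\<integral>\<^sup>+i. f i \<partial>count_space A) \<le> (\<integral>\<^sup>+i. f i \<partial>count_space B)"
  by (subst (1 2) nn_integral_count_space_indicator)
    (use assms in \<open>auto intro!: nn_integral_mono split: split_indicator\<close>)

text \<open>Makes Fubini, change of variables and additivity of the integral available for the sums
  in the cost. As the index set lies in the naturals, the integral is a supremum of partial sums,
  each over a finite subset.\<close>

lemma esum_eq_nn_integral:
  fixes f :: "nat \<Rightarrow> ennreal"
  shows "esum f S = (\<integral>\<^sup>+i. f i \<partial>count_space S)"
proof (rule antisym)
  show "esum f S \<le> (\<integral>\<^sup>+i. f i \<partial>count_space S)"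
    unfolding esum_def
  proof (rule SUP_least)
    fix F assume "F \<in> {F. finite F \<and> F \<subseteq> S}"
    then have "sum f F = (\<integral>\<^sup>+i. f i \<partial>count_space F)" "F \<subseteq> S"
      by (simp_all add: nn_integral_count_space_finite)
    then show "sum f F \<le> (\<integral>\<^sup>+i. f i \<partial>count_space S)"
      by (simp add: nn_integral_count_space_mono)
  qed
  have "(\<integral>\<^sup>+i. f i \<partial>count_space S) = (\<Sum>i. f i * indicator S i)"
    by (subst nn_integral_count_space_indicator) (simp_all add: nn_integral_count_space_nat)
  also have "\<dots> = (SUP n. \<Sum>i<n. f i * indicator S i)"
    by (rule suminf_eq_SUP)
  also have "\<dots> \<le> esum f S"
  proof (rule SUP_least)
    fix n
    have "(\<Sum>i<n. f i * indicator S i) = sum f ({..<n} \<inter> S)"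
      by (simp add: sum.inter_restrict indicator_def if_distrib cong: if_cong)
    also have "\<dots> \<le> esum f S"
      unfolding esum_def by (rule SUP_upper) simp
    finally show "(\<Sum>i<n. f i * indicator S i) \<le> esum f S" .
  qed
  finally show "(\<integral>\<^sup>+i. f i \<partial>count_space S) \<le> esum f S" .
qed

text \<open>All separating functions on diagrams have this form. The integral admits infinite
  multiplicities, and the convention that 0 times \<infinity> is 0 makes points irrelevant where
  \<open>h\<close> vanishes.\<close>

definition dsum :: "('a \<Rightarrow> ennreal) \<Rightarrow> 'a diag \<Rightarrow> ennreal" where
  "dsum h \<alpha> = (\<integral>\<^sup>+a. h a * ennreal_of_enat (\<alpha> a) \<partial>count_space UNIV)"

text \<open>Spread \<open>h (x i)\<close> over the points \<open>a\<close> by indicators and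
  exchange the two sums: the inner one then counts the indices that carry \<open>a\<close>, which is
  the multiplicity.\<close>

lemma dsum_represents:
  assumes "represents \<alpha> I x"
  shows "dsum h \<alpha> = (\<integral>\<^sup>+i. h (x i) \<partial>count_space I)"
proof -
  have "h (x i) = (\<integral>\<^sup>+a. h a * indicator {a} (x i) \<partial>count_space UNIV)" for i
    by (subst nn_integral_count_space'[of "{x i}"]) auto
  then have "(\<integral>\<^sup>+i. h (x i) \<partial>count_space I)
      = (\<integral>\<^sup>+i. \<integral>\<^sup>+a. h a * indicator {a} (x i) \<partial>count_space UNIV \<partial>count_space I)"
    by simp
  also have "\<dots> = (\<integral>\<^sup>+a. \<integral>\<^sup>+i. h a * indicator {a} (x i) \<partial>count_space I \<partial>count_space UNIV)"
    by (rule nn_integral_count_space_nn_integral[symmetric]) auto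
  also have "\<dots> = dsum h \<alpha>"
    unfolding dsum_def
  proof (rule nn_integral_cong)
    fix a
    have "(\<integral>\<^sup>+i. h a * indicator {a} (x i) \<partial>count_space I)
        = (\<integral>\<^sup>+i. h a * indicator {i\<in>I. x i = a} i \<partial>count_space I)"
      by (rule nn_integral_cong) (auto split: split_indicator)
    also have "\<dots> = h a * emeasure (count_space I) {i\<in>I. x i = a}"
      by (rule nn_integral_cmult_indicator) auto
    also have "emeasure (count_space I) {i\<in>I. x i = a} = ennreal_of_enat (ecard {i\<in>I. x i = a})"
      by (subst emeasure_count_space) (auto simp: ecard_def)
    finally show "(\<integral>\<^sup>+i. h a * indicator {a} (x i) \<partial>count_space I) = h a * ennreal_of_enat (\<alpha> a)"
      using assms by (simp add: represents_def)
  qed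
  finally show ?thesis by simp
qed

lemma dsum_mono: "(\<And>a. f a \<le> g a) \<Longrightarrow> dsum f \<alpha> \<le> dsum g \<alpha>"
  unfolding dsum_def by (intro nn_integral_mono mult_right_mono) auto

lemma dsum_add: "dsum (\<lambda>a. f a + g a) \<alpha> = dsum f \<alpha> + dsum g \<alpha>"
  unfolding dsum_def by (simp add: distrib_right nn_integral_add)

lemma dsum_cmult: "dsum (\<lambda>a. c * f a) \<alpha> = c * dsum f \<alpha>"
  unfolding dsum_def by (simp add: mult.assoc nn_integral_cmult)

lemma dsum_finite:
  assumes "finite {a. h a \<noteq> 0 \<and> \<alpha> a \<noteq> 0}" "\<And>a. h a \<noteq> \<infinity>" "\<And>a. h a \<noteq> 0 \<Longrightarrow> \<alpha> a \<noteq> \<infinity>"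
  shows "dsum h \<alpha> < \<infinity>"
proof -
  have "dsum h \<alpha> = (\<Sum>a\<in>{a. h a \<noteq> 0 \<and> \<alpha> a \<noteq> 0}. h a * ennreal_of_enat (\<alpha> a))"
    unfolding dsum_def using assms(1) by (intro nn_integral_count_space') auto
  also have "\<dots> < \<infinity>"
  proof -
    have "h a * ennreal_of_enat (\<alpha> a) < top" if "h a \<noteq> 0" for a
      using assms(2)[of a] assms(3)[OF that]
      by (cases "\<alpha> a") (auto simp: ennreal_mult_less_top less_top of_nat_less_top)
    then show ?thesis by (simp add: assms(1) less_top)
  qed
  finally show ?thesis .
qed

section \<open>Symmetry of the distance and comparison of sums along a matching\<close>

lemma is_matching_swap:
  assumes "is_matching A \<alpha> \<beta> I x J y K \<phi> z w"
  shows "is_matching A \<beta> \<alpha> J y I x (\<phi> ` K) (inv_into K \<phi>) w z"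
  using assms unfolding is_matching_def
  by (auto simp: inv_into_into inj_on_inv_into)

text \<open>Reading a matching backwards exchanges the two terms for unmatched points and reindexes
  the matched pairs along \<phi>.\<close>

lemma matching_cost_swap:
  assumes "ext_metric d" and m: "is_matching A \<alpha> \<beta> I x J y K \<phi> z w"
  shows "matching_cost d p J y I x (\<phi> ` K) (inv_into K \<phi>) w z = matching_cost d p I x J y K \<phi> z w"
proof -
  have sym: "d a b = d b a" for a b
    using assms(1) by (auto simp: ext_metric_def)
  have inj: "inj_on \<phi> K" using m by (simp add: is_matching_def)
  have im: "inv_into K \<phi> ` \<phi> ` K = K"
    using inj by (simp add: image_image cong: image_cong)
  have *: "esum (\<lambda>k. epowr (d (y k) (x (inv_into K \<phi> k))) q) (\<phi> ` K)
      = esum (\<lambda>k. epowr (d (x k) (y (\<phi> k))) q) K" for q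
    unfolding esum_eq_nn_integral
    using inj by (subst nn_integral_bij_count_space[of \<phi> K, symmetric])
      (auto simp: bij_betw_def sym intro!: nn_integral_cong)
  have **: "(SUP k\<in>\<phi> ` K. d (y k) (x (inv_into K \<phi> k))) = (SUP k\<in>K. d (x k) (y (\<phi> k)))"
    using inj by (simp add: image_image sym cong: image_cong)
  show ?thesis
    unfolding matching_cost_def im * **
    by (simp add: sym ac_simps sup.commute sup.left_commute)
qed

lemma Wp_commute:
  assumes "ext_metric d"
  shows "Wp d A p \<alpha> \<beta> = Wp d A p \<beta> \<alpha>"
proof -
  have "{matching_cost d p I x J y K \<phi> z w | I x J y K \<phi> z w. is_matching A \<alpha> \<beta> I x J y K \<phi> z w}
      \<subseteq> {matching_cost d p I x J y K \<phi> z w | I x J y K \<phi> z w. is_matching A \<beta> \<alpha> I x J y K \<phi> z w}"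
    for \<alpha> \<beta> :: "'a diag"
  proof
    fix c assume "c \<in> {matching_cost d p I x J y K \<phi> z w | I x J y K \<phi> z w. is_matching A \<alpha> \<beta> I x J y K \<phi> z w}"
    then obtain I x J y K \<phi> z w where m: "is_matching A \<alpha> \<beta> I x J y K \<phi> z w"
      and c: "c = matching_cost d p I x J y K \<phi> z w"
      by (elim CollectE exE conjE)
    have "c = matching_cost d p J y I x (\<phi> ` K) (inv_into K \<phi>) w z"
      using matching_cost_swap[OF assms m] c by simp
    with is_matching_swap[OF m]
    show "c \<in> {matching_cost d p I x J y K \<phi> z w | I x J y K \<phi> z w. is_matching A \<beta> \<alpha> I x J y K \<phi> z w}"
      by (intro CollectI exI conjI)
  qed
  then show ?thesis unfolding Wp_def by (metis (no_types, lifting) subset_antisym)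
qed

lemma Wp_lessE:
  assumes "Wp d A p \<alpha> \<beta> < r"
  obtains I x J y K \<phi> z w where "is_matching A \<alpha> \<beta> I x J y K \<phi> z w"
    "matching_cost d p I x J y K \<phi> z w < r"
  using assms unfolding Wp_def INF_less_iff by (elim bexE CollectE exE conjE) simp

lemma Wp_le:
  assumes "is_matching A \<alpha> \<beta> I x J y K \<phi> z w"
  shows "Wp d A p \<alpha> \<beta> \<le> matching_cost d p I x J y K \<phi> z w"
  unfolding Wp_def by (rule INF_lower) (use assms in blast)

text \<open>The source of all continuity estimates: \<open>e i\<close> is an error charged to the
  \<open>i\<close>-th entry of \<alpha>. Unmatched entries of \<beta> only enlarge the right-hand
  side.\<close>

lemma dsum_le_matching:
  assumes m: "is_matching A \<alpha> \<beta> I x J y K \<phi> z w"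
    and K: "\<And>k. k \<in> K \<Longrightarrow> f (x k) \<le> g (y (\<phi> k)) + e k"
    and IK: "\<And>i. i \<in> I - K \<Longrightarrow> f (x i) \<le> e i"
  shows "dsum f \<alpha> \<le> dsum g \<beta> + (\<integral>\<^sup>+i. e i \<partial>count_space I)"
proof -
  have rep: "represents \<alpha> I x" "represents \<beta> J y" and sub: "K \<subseteq> I" "\<phi> ` K \<subseteq> J"
    and inj: "inj_on \<phi> K"
    using m by (auto simp: is_matching_def)
  define g' where "g' = (\<lambda>i. if i \<in> K then g (y (\<phi> i)) else 0)"
  have "dsum f \<alpha> = (\<integral>\<^sup>+i. f (x i) \<partial>count_space I)"
    by (rule dsum_represents[OF rep(1)])
  also have "\<dots> \<le> (\<integral>\<^sup>+i. g' i + e i \<partial>count_space I)"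
    using K IK by (intro nn_integral_mono) (auto simp: g'_def)
  also have "\<dots> = (\<integral>\<^sup>+i. g' i \<partial>count_space I) + (\<integral>\<^sup>+i. e i \<partial>count_space I)"
    by (rule nn_integral_add) auto
  also have "(\<integral>\<^sup>+i. g' i \<partial>count_space I) = (\<integral>\<^sup>+i. g' i \<partial>count_space K)"
    using sub by (intro nn_integral_count_space_eq) (auto simp: g'_def)
  also have "\<dots> = (\<integral>\<^sup>+k. g (y (\<phi> k)) \<partial>count_space K)"
    by (rule nn_integral_cong) (simp add: g'_def)
  also have "\<dots> = (\<integral>\<^sup>+j. g (y j) \<partial>count_space (\<phi> ` K))"
    using inj by (intro nn_integral_bij_count_space) (simp add: bij_betw_def)
  also have "\<dots> \<le> (\<integral>\<^sup>+j. g (y j) \<partial>count_space J)"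
    using sub(2) by (rule nn_integral_count_space_mono)
  also have "\<dots> = dsum g \<beta>"
    by (rule dsum_represents[OF rep(2), symmetric])
  finally show ?thesis by (simp add: add_right_mono)
qed

text \<open>A sup-cost below \<open>r\<close> bounds the distance in every single pair, so entries
  can be compared one by one without error. An unmatched entry is compared with its partner in
  \<open>A\<close>, where \<open>g\<close> vanishes.\<close>

lemma dsum_le_Wp_infinity:
  assumes W: "Wp d A \<infinity> \<alpha> \<beta> < r"
    and fg: "\<And>a b. d a b < r \<Longrightarrow> f a \<le> g b" and g: "\<And>b. b \<in> A \<Longrightarrow> g b = 0"
  shows "dsum f \<alpha> \<le> dsum g \<beta>"
proof -
  obtain I x J y K \<phi> z w where m: "is_matching A \<alpha> \<beta> I x J y K \<phi> z w"
    and c: "matching_cost d \<infinity> I x J y K \<phi> z w < r"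
    using Wp_lessE[OF W] .
  have c': "(SUP k\<in>K. d (x k) (y (\<phi> k))) < r" "(SUP i\<in>I - K. d (x i) (z i)) < r"
    by (rule le_less_trans[OF _ c], simp add: matching_cost_def le_supI1 le_supI2)+
  have "d (x k) (y (\<phi> k)) < r" if "k \<in> K" for k
    using SUP_lessD[OF c'(1)] that by auto
  moreover have "d (x i) (z i) < r" if "i \<in> I - K" for i
    using SUP_lessD[OF c'(2)] that by auto
  moreover have "z i \<in> A" if "i \<in> I - K" for i
    using m that by (auto simp: is_matching_def)
  ultimately have "dsum f \<alpha> \<le> dsum g \<beta> + (\<integral>\<^sup>+i. 0 \<partial>count_space I)"
    using fg g by (intro dsum_le_matching[OF m]) (force+)
  then show ?thesis by simp
qed

text \<open>Undoes the outer root of the cost; the strict bound by a real number excludes an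
  infinite \<open>t\<close>.\<close>

lemma epowr_less_imp_le:
  assumes "epowr t (1 / q) < ennreal r" "q > 0"
  shows "t \<le> ennreal (r powr q)"
proof (cases t rule: ennreal_cases)
  case (real u)
  then have "ennreal (u powr (1 / q)) < ennreal r" using assms(1) by (simp add: epowr_def)
  then have "u powr (1 / q) < r" by (simp add: ennreal_less_iff)
  then have "(u powr (1 / q)) powr q \<le> r powr q"
    using assms(2) by (intro powr_mono2) auto
  then show ?thesis using real assms(2) by (simp add: powr_powr ennreal_leI)
qed (use assms in \<open>simp add: epowr_def\<close>)

lemma enn2real_pos: "1 \<le> p \<Longrightarrow> p \<noteq> \<infinity> \<Longrightarrow> 0 < enn2real p"
  by (metis enn2real_positive_iff less_top less_le_trans zero_less_one infinity_ennreal_def)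

text \<open>The errors of the pairs containing an entry of \<alpha> add up to at most
  \<open>C\<close> times the power \<open>enn2real p\<close> of the cost. Unmatched entries are
  again compared with points of \<open>A\<close>.\<close>

lemma dsum_le_Wp_finite:
  assumes W: "Wp d A p \<alpha> \<beta> < ennreal r" and p: "1 \<le> p" "p \<noteq> \<infinity>"
    and fg: "\<And>a b. f a \<le> g b + C * epowr (d a b) (enn2real p)" and g: "\<And>b. b \<in> A \<Longrightarrow> g b = 0"
  shows "dsum f \<alpha> \<le> dsum g \<beta> + C * ennreal (r powr enn2real p)"
proof -
  define q where "q = enn2real p"
  have q: "q > 0" using p unfolding q_def by (rule enn2real_pos)
  obtain I x J y K \<phi> z w where m: "is_matching A \<alpha> \<beta> I x J y K \<phi> z w"
    and c: "matching_cost d p I x J y K \<phi> z w < ennreal r"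
    using Wp_lessE[OF W] .
  have sub: "K \<subseteq> I" and z: "\<And>i. i \<in> I - K \<Longrightarrow> z i \<in> A"
    using m by (auto simp: is_matching_def)
  \<comment> \<open>Using the actual partner of \<open>x i\<close>, whether in \<beta> or in
    \<open>A\<close>, merges the first two sums of the cost into one integral over
    \<open>I\<close>.\<close>
  define D where "D = (\<lambda>i. epowr (d (x i) (if i \<in> K then y (\<phi> i) else z i)) q)"
  have "(\<integral>\<^sup>+i. D i \<partial>count_space I)
      = (\<integral>\<^sup>+i. D i * indicator K i + D i * indicator (I - K) i \<partial>count_space I)"
    by (rule nn_integral_cong) (auto split: split_indicator)
  also have "\<dots> = (\<integral>\<^sup>+i. D i * indicator K i \<partial>count_space I) + (\<integral>\<^sup>+i. D i * indicator (I - K) i \<partial>count_space I)"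
    by (rule nn_integral_add) auto
  also have "(\<integral>\<^sup>+i. D i * indicator K i \<partial>count_space I) = (\<integral>\<^sup>+i. D i * indicator K i \<partial>count_space K)"
    using sub by (intro nn_integral_count_space_eq) (auto split: split_indicator)
  also have "\<dots> = esum (\<lambda>k. epowr (d (x k) (y (\<phi> k))) q) K"
    unfolding esum_eq_nn_integral by (rule nn_integral_cong) (simp add: D_def)
  also have "(\<integral>\<^sup>+i. D i * indicator (I - K) i \<partial>count_space I) = (\<integral>\<^sup>+i. D i * indicator (I - K) i \<partial>count_space (I - K))"
    by (intro nn_integral_count_space_eq) (auto split: split_indicator)
  also have "\<dots> = esum (\<lambda>i. epowr (d (x i) (z i)) q) (I - K)"
    unfolding esum_eq_nn_integral by (rule nn_integral_cong) (simp add: D_def)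
  also have "esum (\<lambda>k. epowr (d (x k) (y (\<phi> k))) q) K + esum (\<lambda>i. epowr (d (x i) (z i)) q) (I - K)
      \<le> esum (\<lambda>k. epowr (d (x k) (y (\<phi> k))) q) K + esum (\<lambda>i. epowr (d (x i) (z i)) q) (I - K)
          + esum (\<lambda>j. epowr (d (w j) (y j)) q) (J - \<phi> ` K)"
    by simp
  also have "\<dots> \<le> ennreal (r powr q)"
    using c p by (intro epowr_less_imp_le q) (simp add: matching_cost_def q_def)
  finally have D: "(\<integral>\<^sup>+i. D i \<partial>count_space I) \<le> ennreal (r powr q)" .
  have "dsum f \<alpha> \<le> dsum g \<beta> + (\<integral>\<^sup>+i. C * D i \<partial>count_space I)"
  proof (rule dsum_le_matching[OF m])
    show "f (x k) \<le> g (y (\<phi> k)) + C * D k" if "k \<in> K" for k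
      using fg[of "x k" "y (\<phi> k)"] that by (simp add: D_def q_def)
    show "f (x i) \<le> C * D i" if "i \<in> I - K" for i
      using fg[of "x i" "z i"] g[OF z[OF that]] that by (simp add: D_def q_def)
  qed
  also have "(\<integral>\<^sup>+i. C * D i \<partial>count_space I) = C * (\<integral>\<^sup>+i. D i \<partial>count_space I)"
    by (rule nn_integral_cmult) auto
  also have "\<dots> \<le> C * ennreal (r powr q)" using D by (rule mult_left_mono) simp
  finally show ?thesis by (simp add: q_def add_left_mono)
qed

section \<open>Distance to the closed subset\<close>

text \<open>If the inequality failed, \<open>d a b\<close> would be finite and could be subtracted.
  The gap would then admit a point \<open>a'\<close> of \<open>A\<close> so close to
  \<open>b\<close> that the detour through \<open>b\<close> contradicts the infimum at
  \<open>a\<close>.\<close>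

lemma setdist_e_triangle:
  assumes "ext_metric d"
  shows "setdist_e d a A \<le> d a b + setdist_e d b A"
proof (rule ccontr)
  assume "\<not> ?thesis"
  then have lt: "d a b + setdist_e d b A < setdist_e d a A" by simp
  then have fin: "d a b < top" "setdist_e d b A < top"
    by (metis add_top_left_ennreal add_top_right_ennreal not_less top_greatest top.not_eq_extremum)+
  have "setdist_e d b A < setdist_e d a A - d a b"
    using lt fin
    by (cases "d a b"; cases "setdist_e d b A"; cases "setdist_e d a A")
      (auto simp: ennreal_minus ennreal_less_iff simp flip: ennreal_plus)
  then obtain a' where a': "a' \<in> A" "d b a' < setdist_e d a A - d a b"
    unfolding setdist_e_def[of d b] INF_less_iff by blast
  have "setdist_e d a A \<le> d a a'" unfolding setdist_e_def using a'(1) by (rule INF_lower)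
  also have "\<dots> \<le> d a b + d b a'" using assms unfolding ext_metric_def by blast
  finally have "setdist_e d a A - d a b \<le> d b a'"
    using fin(1) by (auto simp: ennreal_minus_le_iff)
  with a'(2) show False by simp
qed

lemma setdist_e_triangle':
  assumes "ext_metric d"
  shows "setdist_e d a A \<le> setdist_e d b A + d a b"
  using setdist_e_triangle[OF assms, of a A b] by (simp add: add.commute)

lemma setdist_e_zero: "ext_metric d \<Longrightarrow> a \<in> A \<Longrightarrow> setdist_e d a A = 0"
  unfolding setdist_e_def ext_metric_def by (metis INF_lower le_zero_eq)

lemma setdist_e_le: "b \<in> A \<Longrightarrow> setdist_e d a A \<le> d a b"
  unfolding setdist_e_def by (rule INF_lower)

text \<open>Closedness of \<open>A\<close> gives a ball around \<open>x\<close> that misses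
  \<open>A\<close>; its radius bounds the infimum from below.\<close>

lemma setdist_e_pos:
  assumes "metric_pair d A" "x \<notin> A"
  shows "setdist_e d x A > 0"
proof -
  have "openin (ext_metric_topology UNIV d) (- A)"
    using assms(1) by (simp add: metric_pair_def closedin_def Compl_eq_Diff_UNIV)
  then obtain r where r: "r > 0" "{y. d x y < r} \<subseteq> - A"
    using assms(2) by (auto simp: openin_ext_metric_topology)
  have "r \<le> setdist_e d x A"
    unfolding setdist_e_def by (rule INF_greatest) (use r(2) in \<open>force simp: not_less[symmetric]\<close>)
  with r(1) show ?thesis by simp
qed

lemma not_isolated_obtains:
  assumes "metric_pair d A" "\<not> isolated_subset d A" "\<delta> > 0"
  obtains x where "x \<notin> A" "setdist_e d x A < \<delta>"
proof -
  have "A \<subseteq> thicken d A \<delta>"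
    using assms(1,3) by (auto simp: thicken_def metric_pair_def setdist_e_zero)
  moreover have "thicken d A \<delta> \<noteq> A" using assms(2,3) unfolding isolated_subset_def by blast
  ultimately obtain x where "x \<in> thicken d A \<delta>" "x \<notin> A" by blast
  then show thesis by (intro that) (auto simp: thicken_def)
qed

section \<open>Multiples of one point, the diagrams that will escape compact sets\<close>

definition copies :: "nat \<Rightarrow> 'a \<Rightarrow> 'a diag" where
  "copies k x = (\<lambda>a. if a = x then enat k else 0)"

lemma copies_0: "copies 0 x = zero_diag"
  by (auto simp: copies_def zero_diag_def zero_enat_def)

lemma copies_in_Dfin: "x \<notin> A \<Longrightarrow> copies k x \<in> Dfin A"
proof -
  assume x: "x \<notin> A"
  have sub: "{a. copies k x a \<noteq> 0} \<subseteq> {x}" by (auto simp: copies_def)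
  then have "finite {a. copies k x a \<noteq> 0}" by (rule finite_subset) simp
  with x show ?thesis by (auto simp: Dfin_def Dbar_def countable_finite copies_def zero_enat_def)
qed

lemma dsum_copies: "dsum h (copies k x) = h x * of_nat k"
  unfolding dsum_def by (subst nn_integral_count_space'[of "{x}"]) (auto simp: copies_def)

text \<open>Sending every copy to the same point \<open>b\<close> reduces the cost to a formula in
  the one distance \<open>d b x\<close>.\<close>

lemma matching_copies:
  assumes "b \<in> A"
  shows "is_matching A zero_diag (copies k x) {} (\<lambda>_. x) {..<k} (\<lambda>_. x) {} id (\<lambda>_. x) (\<lambda>_. b)"
  using assms by (auto simp: is_matching_def represents_def copies_def zero_diag_def ecard_def zero_enat_def)

lemma Wp_copies_infinity:
  assumes "b \<in> A"
  shows "Wp d A \<infinity> zero_diag (copies k x) \<le> d b x"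
proof -
  have "Wp d A \<infinity> zero_diag (copies k x) \<le> (SUP j\<in>{..<k}. d b x)"
    using Wp_le[OF matching_copies[OF assms, of k x], of d \<infinity>]
    by (simp add: matching_cost_def bot_ennreal sup_absorb2)
  also have "\<dots> \<le> d b x" by (rule SUP_least) simp
  finally show ?thesis .
qed

lemma Wp_copies_finite:
  assumes "b \<in> A" "p \<noteq> \<infinity>" "d b x = ennreal D" "D \<ge> 0"
  shows "Wp d A p zero_diag (copies k x)
    \<le> ennreal ((real k * D powr enn2real p) powr (1 / enn2real p))"
proof -
  define q where "q = enn2real p"
  have "esum (\<lambda>j::nat. epowr (d b x) q) {..<k} = of_nat k * ennreal (D powr q)"
    unfolding esum_eq_nn_integral using assms
    by (simp add: nn_integral_count_space_finite epowr_def mult.commute)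
  also have "\<dots> = ennreal (real k * D powr q)"
    by (simp add: ennreal_mult ennreal_of_nat_eq_real_of_nat)
  finally have "esum (\<lambda>j::nat. epowr (d b x) q) {..<k} = ennreal (real k * D powr q)" .
  moreover have "esum f {} = 0" for f :: "nat \<Rightarrow> ennreal"
    by (simp add: esum_eq_nn_integral nn_integral_count_space_finite)
  ultimately have "matching_cost d p {} (\<lambda>_. x) {..<k} (\<lambda>_. x) {} id (\<lambda>_. x) (\<lambda>_. b)
      = ennreal ((real k * D powr q) powr (1 / q))"
    using assms(2) by (simp add: matching_cost_def epowr_def flip: q_def)
  then show ?thesis
    using Wp_le[OF matching_copies[OF assms(1), of k x], of d p] by (simp add: q_def)
qed

section \<open>Finiteness and continuity of sums over diagrams\<close>

text \<open>Each nonzero multiplicity is at least 1, so an infinite support has finite subsets of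
  arbitrarily large sum.\<close>

lemma dcard_finite_iff:
  fixes \<alpha> :: "'a diag"
  shows "dcard \<alpha> < \<infinity> \<longleftrightarrow> finite {a. \<alpha> a \<noteq> 0} \<and> (\<forall>a. \<alpha> a \<noteq> \<infinity>)"
proof
  assume fin: "dcard \<alpha> < \<infinity>"
  have up: "sum \<alpha> F \<le> dcard \<alpha>" if "finite F" for F :: "'a set"
    unfolding dcard_def esum_def by (rule SUP_upper) (use that in simp)
  have "\<alpha> a < \<infinity>" for a using le_less_trans[OF up[of "{a}"] fin] by simp
  moreover have "finite {a. \<alpha> a \<noteq> 0}"
  proof (rule ccontr)
    assume inf: "infinite {a. \<alpha> a \<noteq> 0}"
    obtain n where n: "dcard \<alpha> = enat n" using fin by auto
    obtain F where F: "finite F" "card F = Suc n" "F \<subseteq> {a. \<alpha> a \<noteq> 0}"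
      using infinite_arbitrarily_large[OF inf, of "Suc n"] by blast
    have "enat (Suc n) = (\<Sum>a\<in>F. 1)" using F(2) by (simp add: of_nat_eq_enat)
    also have "\<dots> \<le> sum \<alpha> F"
      using F(3) by (intro sum_mono) (auto simp: one_eSuc ileI1 zero_less_iff_neq_zero)
    also have "\<dots> \<le> enat n" using up[OF F(1)] n by simp
    finally show False by simp
  qed
  ultimately show "finite {a. \<alpha> a \<noteq> 0} \<and> (\<forall>a. \<alpha> a \<noteq> \<infinity>)" by auto
next
  assume fin: "finite {a. \<alpha> a \<noteq> 0} \<and> (\<forall>a. \<alpha> a \<noteq> \<infinity>)"
  have "dcard \<alpha> \<le> sum \<alpha> {a. \<alpha> a \<noteq> 0}"
    unfolding dcard_def esum_def
  proof (rule SUP_least)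
    fix F :: "'a set" assume "F \<in> {F. finite F \<and> F \<subseteq> UNIV}"
    then have "sum \<alpha> F = sum \<alpha> (F \<inter> {a. \<alpha> a \<noteq> 0})"
      by (intro sum.mono_neutral_right) auto
    also have "\<dots> \<le> sum \<alpha> {a. \<alpha> a \<noteq> 0}"
      using fin by (intro sum_mono2) auto
    finally show "sum \<alpha> F \<le> sum \<alpha> {a. \<alpha> a \<noteq> 0}" .
  qed
  also have "sum \<alpha> {a. \<alpha> a \<noteq> 0} < \<infinity>"
  proof -
    have "\<forall>a. \<exists>m. \<alpha> a = enat m" using fin by simp
    then obtain n where n: "\<And>a. \<alpha> a = enat (n a)" by metis
    have "sum \<alpha> F = enat (sum n F)" for F
      by (induction F rule: infinite_finite_induct) (simp_all add: zero_enat_def n)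
    then show ?thesis by simp
  qed
  finally show "dcard \<alpha> < \<infinity>" .
qed

lemma continuous_map_dsum:
  assumes fin: "\<And>\<alpha>. \<alpha> \<in> S \<Longrightarrow> dsum h \<alpha> < \<infinity>"
    and cont: "\<And>\<alpha> e. \<lbrakk>\<alpha> \<in> S; e > 0\<rbrakk> \<Longrightarrow> \<exists>r>0. \<forall>\<beta>\<in>S. \<rho> \<alpha> \<beta> < r \<longrightarrow>
        dsum h \<beta> \<le> dsum h \<alpha> + ennreal e \<and> dsum h \<alpha> \<le> dsum h \<beta> + ennreal e"
  shows "continuous_map (ext_metric_topology S \<rho>) euclideanreal (\<lambda>\<alpha>. enn2real (dsum h \<alpha>))"
proof (rule continuous_map_ext_metric_topologyI)
  fix \<alpha> and e :: real assume \<alpha>: "\<alpha> \<in> S" and e: "e > 0"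
  \<comment> \<open>Halving \<open>e\<close> turns the weak estimates of the hypothesis into the
    strict one required.\<close>
  obtain r where r: "r > 0" "\<And>\<beta>. \<lbrakk>\<beta> \<in> S; \<rho> \<alpha> \<beta> < r\<rbrakk> \<Longrightarrow>
        dsum h \<beta> \<le> dsum h \<alpha> + ennreal (e / 2) \<and> dsum h \<alpha> \<le> dsum h \<beta> + ennreal (e / 2)"
    using cont[OF \<alpha>, of "e / 2"] e by auto
  have "\<bar>enn2real (dsum h \<beta>) - enn2real (dsum h \<alpha>)\<bar> < e" if \<beta>: "\<beta> \<in> S" "\<rho> \<alpha> \<beta> < r" for \<beta>
  proof -
    obtain u v where "u \<ge> 0" "dsum h \<alpha> = ennreal u" "v \<ge> 0" "dsum h \<beta> = ennreal v"
      using fin[OF \<alpha>] fin[OF \<beta>(1)] by (metis ennreal_cases infinity_ennreal_def less_irrefl)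
    with r(2)[OF \<beta>] e show ?thesis
      by (auto simp flip: ennreal_plus)
  qed
  with r(1) show "\<exists>r>0. \<forall>\<beta>\<in>S. \<rho> \<alpha> \<beta> < r \<longrightarrow> \<bar>enn2real (dsum h \<beta>) - enn2real (dsum h \<alpha>)\<bar> < e"
    by blast
qed

section \<open>Separation from compact sets for infinite exponent\<close>

text \<open>Truncation at \<open>c\<close> makes the distance to \<open>A\<close> real-valued and
  keeps it 1-Lipschitz, so later case distinctions are plain real arithmetic.\<close>

lemma enn2real_min_le_add:
  assumes "u \<le> v + ennreal \<eta>" "0 \<le> \<eta>"
  shows "enn2real (min u (ennreal c)) \<le> enn2real (min v (ennreal c)) + \<eta>"
proof -
  have fin: "min v (ennreal c) < top" by (simp add: min_less_iff_disj)
  have "min u (ennreal c) \<le> min v (ennreal c) + ennreal \<eta>"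
  proof (cases "v \<le> ennreal c")
    case True
    then show ?thesis using assms(1) by (simp add: min_absorb1 min.coboundedI1)
  next
    case False
    then show ?thesis by (simp add: min_absorb2 min.coboundedI2)
  qed
  also have "\<dots> = ennreal (enn2real (min v (ennreal c)) + \<eta>)"
    using fin assms(2) by (simp add: ennreal_plus)
  finally show ?thesis using assms(2) by (intro enn2real_leI) auto
qed

text \<open>Only finitely many entries of a diagram in \<open>S\<close> lie at distance at least
  \<open>c / 4\<close> from \<open>A\<close>, so \<open>F\<close> is finite and continuous, hence
  bounded on \<open>K\<close>. On \<open>copies k x\<close> it grows linearly in \<open>k\<close>,
  while the distance from \<open>zero_diag\<close> stays below \<epsilon> for every
  \<open>k\<close>.\<close>

lemma separation_infinity:
  assumes mp: "metric_pair d A" and ni: "\<not> isolated_subset d A"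
    and copies: "\<And>k x. \<lbrakk>x \<notin> A; setdist_e d x A < \<infinity>\<rbrakk> \<Longrightarrow> copies k x \<in> S"
    and S: "\<And>\<alpha> \<delta>. \<lbrakk>\<alpha> \<in> S; \<delta> > 0\<rbrakk> \<Longrightarrow> dcard (upper d A \<delta> \<alpha>) < \<infinity>"
    and K: "compactin (ext_metric_topology S (Wp d A \<infinity>)) K" and \<epsilon>: "\<epsilon> > 0"
  shows "\<exists>z\<in>S. \<exists>F M. Wp d A \<infinity> zero_diag z < ennreal \<epsilon>
      \<and> continuous_map (ext_metric_topology S (Wp d A \<infinity>)) euclideanreal F
      \<and> (\<forall>k\<in>K. F k \<le> M) \<and> M < F z"
proof -
  have d: "ext_metric d" using mp by (simp add: metric_pair_def)
  define s where "s = (\<lambda>a. setdist_e d a A)"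
  have s_A: "s b = 0" if "b \<in> A" for b using setdist_e_zero[OF d that] by (simp add: s_def)
  obtain x where x: "x \<notin> A" and sx: "s x < ennreal \<epsilon>"
    using not_isolated_obtains[OF mp ni, of "ennreal \<epsilon>"] \<epsilon> unfolding s_def by auto
  obtain b where b: "b \<in> A" "d x b < ennreal \<epsilon>"
    using sx unfolding s_def setdist_e_def INF_less_iff by blast
  obtain c where c: "c > 0" "s x = ennreal c"
    using sx setdist_e_pos[OF mp x] by (cases "s x") (auto simp: s_def)
  \<comment> \<open>Truncating at \<open>c\<close>, the distance of \<open>x\<close> itself, gives
    \<open>h x = c / 2\<close>. The lower threshold in \<open>i\<close> leaves room: after a move by
    less than \<open>c / 4\<close>, a point where \<open>h\<close> is positive still has
    \<open>i\<close> equal to 1.\<close>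
  define t where "t = (\<lambda>a. enn2real (min (s a) (ennreal c)))"
  define h where "h = (\<lambda>a. ennreal (max 0 (t a - c / 2)))"
  define i where "i = (\<lambda>a. if c / 4 \<le> t a then 1 else 0 :: ennreal)"
  have t_A: "t a = 0" if "a \<in> A" for a
    using s_A[OF that] by (simp add: t_def)
  have h_A: "h a = 0" and i_A: "i a = 0" if "a \<in> A" for a
    using c(1) t_A[OF that] by (simp_all add: h_def i_def)
  have t_le: "ennreal (c / 4) \<le> s a" if "c / 4 \<le> t a" for a
  proof -
    have "min (s a) (ennreal c) < top" by (simp add: min_less_iff_disj)
    then have "ennreal (t a) = min (s a) (ennreal c)" by (simp add: t_def)
    with that show ?thesis by (metis ennreal_leI min.boundedE)
  qed
  have supp: "finite {a. f a \<noteq> 0 \<and> \<alpha> a \<noteq> 0}" "\<And>a. f a \<noteq> 0 \<Longrightarrow> \<alpha> a \<noteq> \<infinity>"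
    if \<alpha>: "\<alpha> \<in> S" and f: "\<And>a. f a \<noteq> 0 \<Longrightarrow> ennreal (c / 4) \<le> s a" for \<alpha> and f :: "'a \<Rightarrow> ennreal"
  proof -
    have "upper d A (ennreal (c / 4)) \<alpha> a = \<alpha> a" if "f a \<noteq> 0" for a
      using f[OF that] by (simp add: upper_def restr_def thicken_def s_def not_less)
    moreover have "finite {a. upper d A (ennreal (c / 4)) \<alpha> a \<noteq> 0}"
        "\<And>a. upper d A (ennreal (c / 4)) \<alpha> a \<noteq> \<infinity>"
      using S[OF \<alpha>, of "ennreal (c / 4)"] c(1) unfolding dcard_finite_iff by auto
    ultimately show "finite {a. f a \<noteq> 0 \<and> \<alpha> a \<noteq> 0}" "\<And>a. f a \<noteq> 0 \<Longrightarrow> \<alpha> a \<noteq> \<infinity>"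
      by (auto elim!: rev_finite_subset) metis
  qed
  have h_supp: "ennreal (c / 4) \<le> s a" if "h a \<noteq> 0" for a
    using that c(1) by (intro t_le) (auto simp: h_def ennreal_eq_0_iff)
  have h_fin: "dsum h \<alpha> < \<infinity>" if "\<alpha> \<in> S" for \<alpha>
  proof (rule dsum_finite)
    show "finite {a. h a \<noteq> 0 \<and> \<alpha> a \<noteq> 0}" by (rule supp(1)[OF that h_supp])
    show "h a \<noteq> \<infinity>" for a by (simp add: h_def)
    show "\<alpha> a \<noteq> \<infinity>" if "h a \<noteq> 0" for a
      using supp(2)[of \<alpha> h a] h_supp \<open>\<alpha> \<in> S\<close> that by blast
  qed
  have i_fin: "dsum i \<alpha> < \<infinity>" if "\<alpha> \<in> S" for \<alpha>
    by (intro dsum_finite supp[OF that] t_le) (simp_all add: i_def split: if_splits)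
  define F where "F = (\<lambda>\<alpha>. enn2real (dsum h \<alpha>))"
  have F: "continuous_map (ext_metric_topology S (Wp d A \<infinity>)) euclideanreal F"
    unfolding F_def
  proof (rule continuous_map_dsum)
    fix \<alpha> and e :: real assume \<alpha>: "\<alpha> \<in> S" and e: "e > 0"
    obtain n where n: "n \<ge> 0" "dsum i \<alpha> = ennreal n"
      using i_fin[OF \<alpha>] by (cases "dsum i \<alpha>") auto
    \<comment> \<open>The first bound is the gap between the thresholds of \<open>h\<close> and
      \<open>i\<close>. The second keeps the total error \<eta> times \<open>n\<close> below
      \<open>e\<close>, and \<open>n + 1\<close> avoids dividing by 0.\<close>
    define \<eta> where "\<eta> = min (c / 4) (e / (n + 1))"
    have \<eta>: "\<eta> > 0" "4 * \<eta> \<le> c" using c(1) e n(1) by (auto simp: \<eta>_def)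
    have "\<eta> * n \<le> e / (n + 1) * (n + 1)"
      using e n(1) \<eta>(1) by (intro mult_mono) (auto simp: \<eta>_def)
    then have \<eta>n: "ennreal \<eta> * dsum i \<alpha> \<le> ennreal e"
      using n \<eta>(1) by (simp add: ennreal_leI flip: ennreal_mult)
    have "dsum h \<beta> \<le> dsum h \<alpha> + ennreal e \<and> dsum h \<alpha> \<le> dsum h \<beta> + ennreal e"
      if W: "Wp d A \<infinity> \<alpha> \<beta> < ennreal \<eta>" for \<beta>
    proof
      have lip: "t a \<le> t b + \<eta>" if "d a b < ennreal \<eta>" for a b
      proof -
        have "s a \<le> s b + d a b" unfolding s_def by (rule setdist_e_triangle'[OF d])
        also have "\<dots> \<le> s b + ennreal \<eta>" using that by (intro add_left_mono less_imp_le)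
        finally show ?thesis unfolding t_def using \<eta>(1) by (intro enn2real_min_le_add) auto
      qed
      have add: "h a + ennreal \<eta> * i a = ennreal (max 0 (t a - c / 2) + (if c / 4 \<le> t a then \<eta> else 0))" for a
        using \<eta>(1) by (simp add: h_def i_def)
      have "Wp d A \<infinity> \<beta> \<alpha> < ennreal \<eta>" using W Wp_commute[OF d, of A \<infinity> \<alpha> \<beta>] by simp
      then have "dsum h \<beta> \<le> dsum (\<lambda>a. h a + ennreal \<eta> * i a) \<alpha>"
      proof (rule dsum_le_Wp_infinity)
        fix a b assume "d a b < ennreal \<eta>"
        then have "max 0 (t a - c / 2) \<le> max 0 (t b - c / 2) + (if c / 4 \<le> t b then \<eta> else 0)"
          using lip[of a b] \<eta> c(1) by (auto simp: max_def)
        then show "h a \<le> h b + ennreal \<eta> * i b" unfolding add by (simp add: h_def ennreal_leI)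
      qed (simp add: h_A i_A)
      also have "\<dots> \<le> dsum h \<alpha> + ennreal e" using \<eta>n by (simp add: dsum_add dsum_cmult)
      finally show "dsum h \<beta> \<le> dsum h \<alpha> + ennreal e" .
      \<comment> \<open>The count \<open>n\<close> is known for \<alpha> only, so the error must be
        charged to \<alpha> here too. Lowering \<open>h\<close> by \<eta> first, at a loss counted
        by \<open>i\<close> on \<alpha>, lets the move to \<beta> be error-free.\<close>
      define h' where "h' = (\<lambda>a. ennreal (max 0 (t a - c / 2 - \<eta>)))"
      have "dsum h \<alpha> \<le> dsum (\<lambda>a. h' a + ennreal \<eta> * i a) \<alpha>"
      proof (rule dsum_mono)
        fix a
        have "max 0 (t a - c / 2) \<le> max 0 (t a - c / 2 - \<eta>) + (if c / 4 \<le> t a then \<eta> else 0)"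
          using \<eta> c(1) by (auto simp: max_def)
        then have "h a \<le> ennreal (max 0 (t a - c / 2 - \<eta>) + (if c / 4 \<le> t a then \<eta> else 0))"
          by (simp add: h_def ennreal_leI)
        also have "\<dots> = h' a + ennreal \<eta> * i a" using \<eta>(1) by (simp add: h'_def i_def)
        finally show "h a \<le> h' a + ennreal \<eta> * i a" .
      qed
      also have "\<dots> = dsum h' \<alpha> + ennreal \<eta> * dsum i \<alpha>"
        by (simp add: dsum_add dsum_cmult)
      also have "dsum h' \<alpha> \<le> dsum h \<beta>"
        using W
      proof (rule dsum_le_Wp_infinity)
        fix a b assume "d a b < ennreal \<eta>"
        then have "max 0 (t a - c / 2 - \<eta>) \<le> max 0 (t b - c / 2)"
          using lip[of a b] by linarith
        then show "h' a \<le> h b" by (simp add: h_def h'_def ennreal_leI)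
      qed (simp add: h_A)
      finally show "dsum h \<alpha> \<le> dsum h \<beta> + ennreal e"
        using \<eta>n by (meson add_mono order_refl order_trans)
    qed
    then show "\<exists>r>0. \<forall>\<beta>\<in>S. Wp d A \<infinity> \<alpha> \<beta> < r \<longrightarrow>
        dsum h \<beta> \<le> dsum h \<alpha> + ennreal e \<and> dsum h \<alpha> \<le> dsum h \<beta> + ennreal e"
      using \<eta>(1) by (intro exI[of _ "ennreal \<eta>"]) simp
  qed (rule h_fin)
  have "compact (F ` K)" using image_compactin[OF K F] by simp
  then obtain M where M: "\<forall>k\<in>K. F k \<le> M"
    by (metis bounded_imp_bdd_above bdd_above.E compact_imp_bounded imageI)
  obtain k :: nat where k: "M / (c / 2) < k" using reals_Archimedean2 by blast
  have "h x = ennreal (c / 2)"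
    using c by (simp add: h_def t_def)
  then have "F (copies k x) = c / 2 * k"
    using c(1) by (simp add: F_def dsum_copies enn2real_mult)
  then have "M < F (copies k x)" using k c(1) by (simp add: field_simps)
  moreover have "Wp d A \<infinity> zero_diag (copies k x) < ennreal \<epsilon>"
    using Wp_copies_infinity[OF b(1), of d k x] b(2) d
    unfolding ext_metric_def by (metis le_less_trans)
  moreover have "copies k x \<in> S" using x c(2) by (intro copies) (simp_all add: s_def)
  ultimately show ?thesis using F M by blast
qed

section \<open>Separation from compact sets for finite exponent\<close>

lemma epowr_mono: "u \<le> v \<Longrightarrow> q > 0 \<Longrightarrow> epowr u q \<le> epowr v q"
  by (auto simp: epowr_def top_unique less_top intro!: ennreal_leI powr_mono2 enn2real_mono)

lemma epowr_0: "epowr 0 q = 0"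
  by (simp add: epowr_def)

lemma epowr_ennreal: "a \<ge> 0 \<Longrightarrow> epowr (ennreal a) q = ennreal (a powr q)"
  by (simp add: epowr_def)

text \<open>Replaces Minkowski's inequality in the continuity estimates below: either \<open>v\<close> is small
  compared to \<open>u\<close>, or \<open>u + v\<close> is bounded by a multiple of \<open>v\<close>.\<close>
lemma epowr_add_le:
  assumes "q > 0" "\<delta> > 0"
  obtains C where "C > 0"
    "\<And>u v. epowr (u + v) q \<le> ennreal (1 + \<delta>) * epowr u q + ennreal C * epowr v q"
proof
  \<comment> \<open>\<tau> solves \<open>(1 + \<tau>) powr q = 1 + \<delta>\<close>. It is the
    threshold for the ratio of \<open>v\<close> to \<open>u\<close>; beyond it \<open>u\<close> is
    at most \<open>v\<close> divided by \<tau>, which dictates \<open>C\<close>.\<close>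
  define \<tau> where "\<tau> = (1 + \<delta>) powr (1 / q) - 1"
  define C where "C = (1 + 1 / \<tau>) powr q"
  have "1 powr (1 / q) < (1 + \<delta>) powr (1 / q)"
    using assms by (intro powr_less_mono2) auto
  then have \<tau>: "\<tau> > 0" by (simp add: \<tau>_def)
  have "1 + 1 / \<tau> > 0" using \<tau> by (simp add: add_pos_pos)
  then show "C > 0" by (simp add: C_def)
  have \<tau>q: "(1 + \<tau>) powr q = 1 + \<delta>" using assms by (simp add: \<tau>_def powr_powr)
  fix u v
  show "epowr (u + v) q \<le> ennreal (1 + \<delta>) * epowr u q + ennreal C * epowr v q"
  proof (cases "u = top \<or> v = top")
    case True
    then show ?thesis
      using assms \<open>C > 0\<close> by (auto simp: epowr_def ennreal_mult_top)
  next
    case False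
    then obtain a b where ab: "u = ennreal a" "a \<ge> 0" "v = ennreal b" "b \<ge> 0"
      by (metis ennreal_cases)
    have "(a + b) powr q \<le> (1 + \<delta>) * a powr q + C * b powr q"
    proof (cases "b \<le> \<tau> * a")
      case True
      then have "(a + b) powr q \<le> ((1 + \<tau>) * a) powr q"
        using ab assms by (intro powr_mono2) (auto simp: algebra_simps)
      also have "\<dots> = (1 + \<delta>) * a powr q"
        using ab \<tau> \<tau>q by (simp add: powr_mult)
      also have "\<dots> \<le> (1 + \<delta>) * a powr q + C * b powr q"
        using \<open>C > 0\<close> by simp
      finally show ?thesis .
    next
      case False
      then have "(a + b) powr q \<le> ((1 + 1 / \<tau>) * b) powr q"
        using ab assms \<tau> by (intro powr_mono2) (auto simp: field_simps)
      also have "\<dots> = C * b powr q"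
        using ab \<tau> by (simp add: powr_mult C_def)
      also have "\<dots> \<le> (1 + \<delta>) * a powr q + C * b powr q"
        using assms by simp
      finally show ?thesis .
    qed
    then have le: "ennreal ((a + b) powr q) \<le> ennreal ((1 + \<delta>) * a powr q + C * b powr q)"
      by (rule ennreal_leI)
    have "ennreal (E * X + C * Y) = ennreal E * ennreal X + ennreal C * ennreal Y"
      if "E \<ge> 0" "X \<ge> 0" "Y \<ge> 0" for E X Y
      using that \<open>C > 0\<close> by (simp add: ennreal_mult)
    note eq = this[of "1 + \<delta>" "a powr q" "b powr q"]
    have "u + v = ennreal (a + b)" using ab by simp
    then have "epowr (u + v) q = ennreal ((a + b) powr q)" using ab by (simp only: epowr_ennreal add_nonneg_nonneg)
    moreover have "epowr u q = ennreal (a powr q)" "epowr v q = ennreal (b powr q)"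
      using ab by (simp_all add: epowr_ennreal)
    ultimately show ?thesis
      using le eq assms(2) by (simp only: add_nonneg_nonneg zero_le_one less_imp_le powr_ge_zero)
  qed
qed

text \<open>Truncated subtraction makes this a tent with slopes of size 1 that vanishes from
  \<open>t\<close> onwards, also at infinite distance. The case split is on the branch attained at
  \<open>v\<close>.\<close>

lemma tent_lipschitz:
  fixes t u v e :: ennreal
  assumes "u \<le> v + e" "v \<le> u + e" "t \<noteq> top"
  shows "min u (t - u) \<le> min v (t - v) + e"
proof (cases "v \<le> t - v")
  case True
  then show ?thesis using assms(1) by (simp add: min_absorb1 min.coboundedI1)
next
  case False
  have "t \<le> v + (t - v)" using ennreal_minus_le_iff[of t v "t - v"] by simp
  also have "\<dots> \<le> u + e + (t - v)" using assms(2) by (rule add_right_mono)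
  finally have "t - u \<le> (t - v) + e"
    using assms(3) by (simp add: ennreal_minus_le_iff ac_simps)
  then show ?thesis using False by (simp add: min_absorb2 min.coboundedI2)
qed

text \<open>The estimate \<open>est\<close> has a factor \<open>1 + \<delta>\<close> and holds in
  both orders. Bounding the sum over \<beta> by the one over \<alpha> comes first; this bound then
  turns the reverse estimate into an additive one.\<close>

lemma continuous_map_tent_sum:
  assumes d: "ext_metric d" and p: "1 \<le> p" "p \<noteq> \<infinity>" and t: "t \<noteq> top"
    and fin: "\<And>\<alpha>. \<alpha> \<in> S \<Longrightarrow> dsum (\<lambda>a. epowr (min (setdist_e d a A) (t - setdist_e d a A)) (enn2real p)) \<alpha> < \<infinity>"
  shows "continuous_map (ext_metric_topology S (Wp d A p)) euclideanreal
    (\<lambda>\<alpha>. enn2real (dsum (\<lambda>a. epowr (min (setdist_e d a A) (t - setdist_e d a A)) (enn2real p)) \<alpha>))"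
proof (rule continuous_map_dsum)
  define q where "q = enn2real p"
  define h where "h = (\<lambda>a. min (setdist_e d a A) (t - setdist_e d a A))"
  define g where "g = (\<lambda>a. epowr (h a) q)"
  have q: "q > 0" using p unfolding q_def by (rule enn2real_pos)
  fix \<alpha> and e :: real assume \<alpha>: "\<alpha> \<in> S" and e: "e > 0"
  obtain m where m: "m \<ge> 0" "dsum g \<alpha> = ennreal m"
    using fin[OF \<alpha>] by (cases "dsum g \<alpha>") (auto simp: g_def h_def q_def)
  \<comment> \<open>The cap at 1 yields \<open>n \<le> m + 1\<close> for the sum \<open>n\<close>
    over \<beta>, and \<delta> is scaled so that the factor \<open>1 + \<delta>\<close> then costs
    at most \<open>e' / 2\<close>.\<close>
  define e' where "e' = min e 1"
  define \<delta> where "\<delta> = e' / (2 * (m + 1))"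
  have e': "e' > 0" "e' \<le> e" "e' \<le> 1" using e by (auto simp: e'_def)
  have \<delta>: "\<delta> > 0" using e' m by (simp add: \<delta>_def)
  have \<delta>m: "\<delta> * (m + 1) = e' / 2" using m(1) by (simp add: \<delta>_def field_simps)
  obtain C where C: "C > 0"
    "\<And>u v. epowr (u + v) q \<le> ennreal (1 + \<delta>) * epowr u q + ennreal C * epowr v q"
    using epowr_add_le[OF q \<delta>] by blast
  define r where "r = (e' / (4 * C)) powr (1 / q)"
  have r: "r > 0" "C * r powr q = e' / 4" using e' C(1) q by (simp_all add: r_def powr_powr)
  have g_A: "g a = 0" if "a \<in> A" for a
    using setdist_e_zero[OF d that] by (simp add: g_def h_def epowr_0)
  have g_le: "g a \<le> ennreal (1 + \<delta>) * g b + ennreal C * epowr (d a b) q" for a b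
  proof -
    have "setdist_e d b A \<le> setdist_e d a A + d a b"
      using setdist_e_triangle'[OF d, of b A a] d unfolding ext_metric_def by metis
    then have "h a \<le> h b + d a b"
      unfolding h_def using setdist_e_triangle'[OF d, of a A b] t by (intro tent_lipschitz)
    then show ?thesis
      unfolding g_def using order_trans[OF epowr_mono C(2)] q by blast
  qed
  have est: "dsum g \<beta> \<le> ennreal (1 + \<delta>) * dsum g \<gamma> + ennreal (e' / 4)"
    if "Wp d A p \<beta> \<gamma> < ennreal r" for \<beta> \<gamma>
  proof -
    have "dsum g \<beta> \<le> dsum (\<lambda>b. ennreal (1 + \<delta>) * g b) \<gamma> + ennreal C * ennreal (r powr enn2real p)"
      using that p by (rule dsum_le_Wp_finite) (use g_le g_A in \<open>simp_all add: q_def\<close>)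
    also have "ennreal C * ennreal (r powr enn2real p) = ennreal (C * r powr q)"
      using C(1) by (simp add: q_def ennreal_mult)
    also have "C * r powr q = e' / 4" by (rule r(2))
    finally show ?thesis by (simp add: dsum_cmult)
  qed
  have "dsum g \<beta> \<le> dsum g \<alpha> + ennreal e \<and> dsum g \<alpha> \<le> dsum g \<beta> + ennreal e"
    if \<beta>: "\<beta> \<in> S" and W: "Wp d A p \<alpha> \<beta> < ennreal r" for \<beta>
  proof -
    obtain n where n: "n \<ge> 0" "dsum g \<beta> = ennreal n"
      using fin[OF \<beta>] by (cases "dsum g \<beta>") (auto simp: g_def h_def q_def)
    have "n \<le> (1 + \<delta>) * m + e' / 4"
      using est[of \<beta> \<alpha>] W Wp_commute[OF d, of A p \<alpha> \<beta>] m n \<delta> e'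
      by (simp flip: ennreal_mult ennreal_plus)
    moreover have "m \<le> (1 + \<delta>) * n + e' / 4"
      using est[OF W] m n \<delta> e' by (simp flip: ennreal_mult ennreal_plus)
    moreover have "\<delta> * m + \<delta> = e' / 2" using \<delta>m by (simp add: algebra_simps)
    ultimately have nm: "n \<le> m + \<delta> * m + e' / 4" "m \<le> n + \<delta> * n + e' / 4" "\<delta> * m \<le> e' / 2"
      using \<delta> by (simp_all add: algebra_simps)
    then have "n \<le> m + 1" using e' by linarith
    then have "\<delta> * n \<le> \<delta> * (m + 1)" using \<delta> by (intro mult_left_mono) auto
    then have "n \<le> m + e" "m \<le> n + e" using nm \<delta>m e' by linarith+
    then show ?thesis using m n e by (simp flip: ennreal_plus)
  qed
  then show "\<exists>r>0. \<forall>\<beta>\<in>S. Wp d A p \<alpha> \<beta> < r \<longrightarrow>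
      dsum (\<lambda>a. epowr (min (setdist_e d a A) (t - setdist_e d a A)) (enn2real p)) \<beta>
        \<le> dsum (\<lambda>a. epowr (min (setdist_e d a A) (t - setdist_e d a A)) (enn2real p)) \<alpha> + ennreal e \<and>
      dsum (\<lambda>a. epowr (min (setdist_e d a A) (t - setdist_e d a A)) (enn2real p)) \<alpha>
        \<le> dsum (\<lambda>a. epowr (min (setdist_e d a A) (t - setdist_e d a A)) (enn2real p)) \<beta> + ennreal e"
    using r(1) unfolding g_def h_def q_def by (intro exI[of _ "ennreal r"]) auto
qed (rule fin)

text \<open>A Dini argument: the tent sums \<open>F (T n)\<close> decrease to 0 on \<open>S\<close>,
  so one of them stays below \<open>e0\<close> on \<open>K\<close>. Narrowing the tent to width
  \<open>2 * c\<close> keeps this bound, while \<open>k\<close> copies of its peak exceed it. They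
  are still cheap, since cost and tent sum are both governed by \<open>k * c powr q\<close>.\<close>

lemma separation_finite:
  assumes mp: "metric_pair d A" and ni: "\<not> isolated_subset d A" and p: "1 \<le> p" "p \<noteq> \<infinity>"
    and copies: "\<And>k x. \<lbrakk>x \<notin> A; setdist_e d x A < \<infinity>\<rbrakk> \<Longrightarrow> copies k x \<in> S"
    and S: "\<And>\<alpha>. \<alpha> \<in> S \<Longrightarrow>
      dsum (\<lambda>a. epowr (if setdist_e d a A = \<infinity> then 0 else setdist_e d a A) (enn2real p)) \<alpha> < \<infinity>"
    and K: "compactin (ext_metric_topology S (Wp d A p)) K" and \<epsilon>: "\<epsilon> > 0"
  shows "\<exists>z\<in>S. \<exists>F M. Wp d A p zero_diag z < ennreal \<epsilon>
      \<and> continuous_map (ext_metric_topology S (Wp d A p)) euclideanreal F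
      \<and> (\<forall>k\<in>K. F k \<le> M) \<and> M < F z"
proof -
  define q where "q = enn2real p"
  have q: "q > 0" using p unfolding q_def by (rule enn2real_pos)
  have d: "ext_metric d" using mp by (simp add: metric_pair_def)
  define s where "s = (\<lambda>a. setdist_e d a A)"
  \<comment> \<open>An integrable majorant of all tents, for dominated convergence; points at
    infinite distance get weight 0, as the tents vanish there.\<close>
  define w where "w = (\<lambda>a. epowr (if s a = \<infinity> then 0 else s a) q)"
  have w_fin: "dsum w \<alpha> < \<infinity>" if "\<alpha> \<in> S" for \<alpha>
    unfolding w_def s_def q_def by (rule S[OF that])
  define g where "g = (\<lambda>t a. epowr (min (s a) (t - s a)) q)"
  have g_w: "g t a \<le> w a" if "t \<noteq> top" for t a
    unfolding g_def w_def using that q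
    by (intro epowr_mono) (auto simp: minus_top_ennreal)
  have g_mono: "g t a \<le> g t' a" if "t \<le> t'" for t t' a
    unfolding g_def using that q by (intro epowr_mono min.mono ennreal_minus_mono) auto
  have g_fin: "dsum (g t) \<alpha> < \<infinity>" if "\<alpha> \<in> S" "t \<noteq> top" for t \<alpha>
    using dsum_mono[OF g_w[OF that(2)]] w_fin[OF that(1)] by (rule le_less_trans)
  define F where "F = (\<lambda>t \<alpha>. enn2real (dsum (g t) \<alpha>))"
  have F: "continuous_map (ext_metric_topology S (Wp d A p)) euclideanreal (F t)"
    if "t \<noteq> top" for t
    using continuous_map_tent_sum[OF d p that, of S A] g_fin[OF _ that]
    by (simp add: F_def g_def s_def q_def)
  have F_mono: "F t \<alpha> \<le> F t' \<alpha>" if "t \<le> t'" "\<alpha> \<in> S" "t' \<noteq> top" for t t' \<alpha>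
    unfolding F_def using dsum_mono[OF g_mono[OF that(1)]] g_fin[OF that(2,3)]
    by (intro enn2real_mono) auto
  define T where "T = (\<lambda>n. ennreal (inverse (real (Suc n))))"
  have T_lim: "T \<longlonglongrightarrow> 0"
    unfolding T_def using tendsto_ennrealI[OF LIMSEQ_inverse_real_of_nat] by simp
  have T_top: "T n \<noteq> top" and T_pos: "T n > 0" for n by (simp_all add: T_def)
  have T_mono: "T n \<le> T m" if "m \<le> n" for m n
    using that by (simp add: T_def ennreal_leI field_simps)
  have g_ev: "\<forall>\<^sub>F n in sequentially. g (T n) a = 0" for a
  proof (cases "s a = 0")
    case True
    then show ?thesis by (simp add: g_def epowr_0)
  next
    case False
    then have "\<forall>\<^sub>F n in sequentially. T n < s a"
      by (intro order_tendstoD(2)[OF T_lim]) (simp add: zero_less_iff_neq_zero)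
    then show ?thesis
    proof eventually_elim
      case (elim n)
      then have "T n - s a = 0" using T_top[of n] by (intro diff_eq_0_ennreal) (auto simp: less_top)
      then show ?case by (simp add: g_def epowr_0)
    qed
  qed
  have F_lim: "(\<lambda>n. F (T n) \<alpha>) \<longlonglongrightarrow> 0" if \<alpha>: "\<alpha> \<in> S" for \<alpha>
  proof -
    have "(\<lambda>n. \<integral>\<^sup>+a. g (T n) a * ennreal_of_enat (\<alpha> a) \<partial>count_space UNIV)
        \<longlonglongrightarrow> (\<integral>\<^sup>+a. 0 \<partial>count_space (UNIV :: 'a set))"
    proof (rule nn_integral_dominated_convergence)
      show "(\<integral>\<^sup>+a. w a * ennreal_of_enat (\<alpha> a) \<partial>count_space UNIV) < \<infinity>"
        using w_fin[OF \<alpha>] by (simp add: dsum_def)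
      show "AE a in count_space UNIV. g (T n) a * ennreal_of_enat (\<alpha> a) \<le> w a * ennreal_of_enat (\<alpha> a)" for n
        using g_w[OF T_top] by (intro AE_I2 mult_right_mono) auto
      have "(\<lambda>n. g (T n) a * ennreal_of_enat (\<alpha> a)) \<longlonglongrightarrow> 0" for a
      proof (rule tendsto_eventually)
        show "\<forall>\<^sub>F n in sequentially. g (T n) a * ennreal_of_enat (\<alpha> a) = 0"
          using g_ev[of a] by eventually_elim simp
      qed
      then show "AE a in count_space UNIV. (\<lambda>n. g (T n) a * ennreal_of_enat (\<alpha> a)) \<longlonglongrightarrow> 0"
        by simp
    qed simp_all
    then have "(\<lambda>n. dsum (g (T n)) \<alpha>) \<longlonglongrightarrow> ennreal 0" by (simp add: dsum_def)
    then show ?thesis unfolding F_def by (rule tendsto_enn2real) simp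
  qed
  \<comment> \<open>The power \<open>q\<close> of the cost will be at most
    \<open>2 powr q * (3 * e0)\<close>; the factor 4 makes this smaller than
    \<open>\<epsilon> powr q\<close>.\<close>
  define e0 where "e0 = \<epsilon> powr q / (4 * 2 powr q)"
  have e0: "e0 > 0" using \<epsilon> by (simp add: e0_def)
  have KS: "K \<subseteq> S" using compactin_subset_topspace[OF K] by simp
  \<comment> \<open>These open sets grow with \<open>n\<close> by \<open>F_mono\<close>, so a finite
    subcover of \<open>K\<close> collapses to a single index \<open>N\<close>.\<close>
  define U where "U = (\<lambda>n. {\<alpha>\<in>S. F (T n) \<alpha> \<in> {..<e0}})"
  have U_open: "openin (ext_metric_topology S (Wp d A p)) (U n)" for n
    using openin_continuous_map_preimage[OF F[OF T_top], of "{..<e0}" n] by (simp add: U_def)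
  have U_cover: "K \<subseteq> \<Union>(range U)"
  proof
    fix \<alpha> assume "\<alpha> \<in> K"
    then have \<alpha>: "\<alpha> \<in> S" using KS by blast
    obtain n where "F (T n) \<alpha> < e0"
      using order_tendstoD(2)[OF F_lim[OF \<alpha>] e0] by (auto simp: eventually_sequentially)
    with \<alpha> show "\<alpha> \<in> \<Union>(range U)" by (auto simp: U_def)
  qed
  have "\<exists>\<F>. finite \<F> \<and> \<F> \<subseteq> range U \<and> K \<subseteq> \<Union>\<F>"
    using U_open U_cover by (intro compactinD[OF K]) auto
  then obtain \<F> where \<F>: "finite \<F>" "\<F> \<subseteq> range U" "K \<subseteq> \<Union>\<F>" by (elim exE conjE)
  obtain I where I: "finite I" "K \<subseteq> \<Union>(U ` I)"
    using finite_subset_image[OF \<F>(1,2)] \<F>(3) by (elim exE conjE) simp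
  obtain N where "\<forall>n\<in>I. n \<le> N"
    using I(1) unfolding finite_nat_set_iff_bounded_le by (elim exE)
  then have N: "n \<le> N" if "n \<in> I" for n using that by (rule bspec)
  have FK: "F (T N) \<alpha> < e0" if "\<alpha> \<in> K" for \<alpha>
  proof -
    obtain n where n: "n \<in> I" "\<alpha> \<in> U n" using I(2) \<open>\<alpha> \<in> K\<close> by blast
    then have "F (T N) \<alpha> \<le> F (T n) \<alpha>"
      by (intro F_mono T_mono N T_top) (auto simp: U_def)
    with n show ?thesis by (simp add: U_def)
  qed

  \<comment> \<open>The first bound gives \<open>2 * c \<le> inverse (real (Suc N))\<close>, so the
    narrower tent inherits the bound on \<open>K\<close>. The second gives
    \<open>c powr q \<le> e0\<close>, so rounding \<open>k\<close> up overshoots by at most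
    \<open>e0\<close>.\<close>
  define \<delta> where "\<delta> = min (inverse (real (Suc N)) / 2) (e0 powr (1 / q))"
  have \<delta>: "\<delta> > 0" using e0 by (simp add: \<delta>_def)
  obtain x where x: "x \<notin> A" and sx: "s x < ennreal \<delta>"
    using not_isolated_obtains[OF mp ni, of "ennreal \<delta>"] \<delta> unfolding s_def by auto
  obtain c where c: "c > 0" "s x = ennreal c"
    using sx setdist_e_pos[OF mp x] by (cases "s x") (auto simp: s_def)
  have c\<delta>: "c < \<delta>" using sx c by (simp add: ennreal_less_iff)
  \<comment> \<open>The infimum need not be attained; a point \<open>b\<close> within twice the
    distance suffices and accounts for the factor \<open>2 powr q\<close> in
    \<open>e0\<close>.\<close>
  have "s x < ennreal (2 * c)" using c by (simp add: ennreal_less_iff)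
  then obtain b where b: "b \<in> A" "d x b < ennreal (2 * c)"
    unfolding s_def setdist_e_def INF_less_iff by blast
  then obtain D where D: "D \<ge> 0" "d b x = ennreal D" "D < 2 * c"
  proof -
    have "d b x = d x b" using d unfolding ext_metric_def by blast
    then show ?thesis using b that by (cases "d x b") (auto simp: ennreal_less_iff)
  qed
  have cq: "c powr q > 0" using c by simp
  have "c powr q \<le> (e0 powr (1 / q)) powr q"
    using c c\<delta> q by (intro powr_mono2) (auto simp: \<delta>_def)
  then have cq_le: "c powr q \<le> e0" using e0 q by (simp add: powr_powr)
  \<comment> \<open>This puts \<open>k * c powr q\<close> between \<open>2 * e0\<close>, which beats
    the bound on \<open>K\<close>, and \<open>3 * e0\<close>, which keeps the cost below
    \<epsilon>.\<close>
  define k where "k = nat \<lceil>2 * e0 / c powr q\<rceil>"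
  have "0 \<le> 2 * e0 / c powr q" using e0 by simp
  then have "0 \<le> \<lceil>2 * e0 / c powr q\<rceil>" by simp
  then have kr: "real k = of_int \<lceil>2 * e0 / c powr q\<rceil>" unfolding k_def by (rule of_nat_nat)
  have "2 * e0 / c powr q \<le> k" unfolding kr by (rule le_of_int_ceiling)
  then have k1: "2 * e0 \<le> k * c powr q" using cq by (simp only: pos_divide_le_eq)
  have "k \<le> 2 * e0 / c powr q + 1" unfolding kr by (rule of_int_ceiling_le_add_one)
  then have "k * c powr q \<le> (2 * e0 / c powr q + 1) * c powr q"
    using cq by (intro mult_right_mono) auto
  also have "\<dots> = 2 * e0 + c powr q" using cq by (simp add: distrib_right)
  finally have k: "2 * e0 \<le> k * c powr q" "k * c powr q \<le> 3 * e0"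
    using k1 cq_le by linarith+
  have "k * D powr q \<le> k * (2 * c) powr q"
    using D q by (intro mult_left_mono powr_mono2) auto
  also have "\<dots> = 2 powr q * (k * c powr q)" using c by (simp add: powr_mult)
  also have "\<dots> \<le> 2 powr q * (3 * e0)" using k(2) by (intro mult_left_mono) auto
  also have "\<dots> < \<epsilon> powr q" using \<epsilon> by (simp add: e0_def)
  finally have "(k * D powr q) powr (1 / q) < (\<epsilon> powr q) powr (1 / q)"
    using q by (intro powr_less_mono2) auto
  then have "ennreal ((k * D powr q) powr (1 / q)) < ennreal \<epsilon>"
    using q \<epsilon> by (simp add: powr_powr ennreal_less_iff)
  then have "Wp d A p zero_diag (copies k x) < ennreal \<epsilon>"
    using Wp_copies_finite[of b A p d x D k] b(1) p(2) D(1,2) unfolding q_def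
    by (simp add: le_less_trans)
  moreover have "F (ennreal (2 * c)) \<alpha> \<le> e0" if "\<alpha> \<in> K" for \<alpha>
  proof -
    have "2 * c \<le> inverse (real (Suc N))" using c\<delta> by (simp add: \<delta>_def)
    then have "F (ennreal (2 * c)) \<alpha> \<le> F (T N) \<alpha>"
      using that KS T_top by (intro F_mono) (auto simp: T_def ennreal_leI)
    then show ?thesis using FK[OF that] by simp
  qed
  moreover have "e0 < F (ennreal (2 * c)) (copies k x)"
  proof -
    have "g (ennreal (2 * c)) x = ennreal (c powr q)"
      using c by (simp add: g_def ennreal_minus epowr_ennreal)
    then have "F (ennreal (2 * c)) (copies k x) = c powr q * k"
      by (simp add: F_def dsum_copies enn2real_mult)
    then show ?thesis using k(1) e0 by (simp add: mult.commute)
  qed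
  moreover have "copies k x \<in> S" using x c(2) by (intro copies) (simp_all add: s_def)
  moreover have "continuous_map (ext_metric_topology S (Wp d A p)) euclideanreal (F (ennreal (2 * c)))"
    by (rule F) simp
  ultimately show ?thesis
    by (intro bexI[of _ "copies k x"] exI[of _ "F (ennreal (2 * c))"] exI[of _ e0]) simp_all
qed

section \<open>The two diagram spaces satisfy the requirements for separation\<close>

text \<open>Any matching with the empty diagram sends every entry to \<open>A\<close>, so its cost
  dominates the sum of the distances to \<open>A\<close>. Passing to \<open>lower\<close> loses
  nothing, as the discarded points have weight 0.\<close>

lemma lower_sum_finite:
  assumes d: "ext_metric d" and p: "1 \<le> p" "p \<noteq> \<infinity>"
    and W: "Wp d A p (lower d A \<infinity> \<alpha>) zero_diag < \<infinity>"
  shows "dsum (\<lambda>a. epowr (if setdist_e d a A = \<infinity> then 0 else setdist_e d a A) (enn2real p)) \<alpha> < \<infinity>"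
proof -
  define q where "q = enn2real p"
  have q: "q > 0" using p unfolding q_def by (rule enn2real_pos)
  define w where "w = (\<lambda>a. epowr (if setdist_e d a A = \<infinity> then 0 else setdist_e d a A) q)"
  obtain r where "r \<ge> 0" "Wp d A p (lower d A \<infinity> \<alpha>) zero_diag = ennreal r"
    using W by (cases "Wp d A p (lower d A \<infinity> \<alpha>) zero_diag") auto
  then have lt: "Wp d A p (lower d A \<infinity> \<alpha>) zero_diag < ennreal (r + 1)"
    by (simp add: ennreal_less_iff)
  have "dsum w \<alpha> = dsum w (lower d A \<infinity> \<alpha>)"
    unfolding dsum_def
  proof (rule nn_integral_cong)
    fix a
    have "w a = 0" if "\<not> (a \<in> thicken d A \<infinity> - A)"
      using that setdist_e_zero[OF d, of a A]
      by (auto simp: w_def thicken_def epowr_0 less_top)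
    then show "w a * ennreal_of_enat (\<alpha> a) = w a * ennreal_of_enat (lower d A \<infinity> \<alpha> a)"
      by (auto simp: lower_def restr_def)
  qed
  \<comment> \<open>The value \<infinity> off \<open>A\<close> makes the pairwise inequality trivial
    there, yet the sum over the empty diagram is 0.\<close>
  also have "\<dots> \<le> dsum (\<lambda>b. if b \<in> A then 0 else \<infinity>) zero_diag + 1 * ennreal ((r + 1) powr enn2real p)"
    using lt p
  proof (rule dsum_le_Wp_finite)
    fix a b
    have "(if setdist_e d a A = \<infinity> then 0 else setdist_e d a A) \<le> d a b" if "b \<in> A"
      using setdist_e_le[OF that, of d a] by simp
    then show "w a \<le> (if b \<in> A then 0 else \<infinity>) + 1 * epowr (d a b) (enn2real p)"
      using q unfolding w_def q_def by (auto intro: epowr_mono)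
  qed simp
  also have "dsum (\<lambda>b. if b \<in> A then 0 else \<infinity>) zero_diag = 0"
    by (simp add: dsum_def zero_diag_def)
  finally show ?thesis
    unfolding w_def q_def by (rule le_less_trans) simp
qed

lemma Dfin_sum_finite:
  assumes "\<alpha> \<in> Dfin A"
  shows "dsum (\<lambda>a. epowr (if setdist_e d a A = \<infinity> then 0 else setdist_e d a A) q) \<alpha> < \<infinity>"
proof (rule dsum_finite)
  show "finite {a. epowr (if setdist_e d a A = \<infinity> then 0 else setdist_e d a A) q \<noteq> 0 \<and> \<alpha> a \<noteq> 0}"
    using assms by (auto simp: Dfin_def elim: rev_finite_subset)
qed (use assms in \<open>auto simp: Dfin_def epowr_def\<close>)

lemma Dfin_dcard_upper:
  assumes "\<alpha> \<in> Dfin A"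
  shows "dcard (upper d A \<delta> \<alpha>) < \<infinity>"
  unfolding dcard_finite_iff
proof
  have "{a. upper d A \<delta> \<alpha> a \<noteq> 0} \<subseteq> {a. \<alpha> a \<noteq> 0}" by (auto simp: upper_def restr_def)
  moreover have "finite {a. \<alpha> a \<noteq> 0}" using assms by (simp add: Dfin_def)
  ultimately show "finite {a. upper d A \<delta> \<alpha> a \<noteq> 0}" by (rule finite_subset)
  show "\<forall>a. upper d A \<delta> \<alpha> a \<noteq> \<infinity>" using assms by (auto simp: Dfin_def upper_def restr_def zero_enat_def)
qed

lemma copies_in_Dbar_p:
  assumes d: "ext_metric d" and x: "x \<notin> A" "setdist_e d x A < \<infinity>"
  shows "copies k x \<in> Dbar_p d A p"
proof -
  have fin: "copies k x \<in> Dfin A" using x(1) by (rule copies_in_Dfin)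
  then have D: "copies k x \<in> Dbar A" by (simp add: Dfin_def)
  show ?thesis
  proof (cases "p = \<infinity>")
    case True
    then show ?thesis using D Dfin_dcard_upper[OF fin] by (simp add: Dbar_p_def)
  next
    case False
    obtain b where b: "b \<in> A" "d x b < \<infinity>"
      using x(2) unfolding setdist_e_def INF_less_iff by blast
    have "d b x = d x b" using d unfolding ext_metric_def by blast
    then obtain D where "D \<ge> 0" "d b x = ennreal D" using b(2) by (cases "d x b") auto
    then have "Wp d A p zero_diag (copies k x) < \<infinity>"
      using Wp_copies_finite[of b A p d x D k] b(1) False by (simp add: le_less_trans)
    moreover have "lower d A \<infinity> (copies k x) = copies k x"
      using x by (auto simp: lower_def restr_def copies_def thicken_def)
    ultimately have "Wp d A p (lower d A \<infinity> (copies k x)) zero_diag < \<infinity>"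
      using Wp_commute[OF d, of A p zero_diag "copies k x"] by simp
    then show ?thesis using D False Dfin_dcard_upper[OF fin] by (simp add: Dbar_p_def)
  qed
qed

theorem theorem7p25:
  fixes d :: "'a \<Rightarrow> 'a \<Rightarrow> ennreal" and A :: "'a set"
    and Y :: "'y topology" and p :: ennreal
  assumes "metric_pair d A"
    and "\<not> isolated_subset d A"
    and "nontrivial_path_in Y"
    and "1 \<le> p"
  shows "\<not> metrizable_space (compact_open (ext_metric_topology (Dfin A) (Wp d A p)) Y)
       \<and> \<not> metrizable_space (compact_open (ext_metric_topology (Dbar_p d A p) (Wp d A p)) Y)"
proof -
  have d: "ext_metric d" using assms(1) by (simp add: metric_pair_def)
  \<comment> \<open>Zero copies of this point are the empty diagram, which places
    \<open>zero_diag\<close> in \<open>S\<close> below.\<close>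
  obtain x where x: "x \<notin> A" "setdist_e d x A < \<infinity>"
    using not_isolated_obtains[OF assms(1,2), of \<infinity>] by auto
  \<comment> \<open>Both spaces are treated at once: the separation lemmas ask only that multiples
    of points at finite distance belong to \<open>S\<close> and that the relevant sums or
    cardinalities are finite.\<close>
  have main: "\<not> metrizable_space (compact_open (ext_metric_topology S (Wp d A p)) Y)"
    if S: "S = Dfin A \<or> S = Dbar_p d A p" for S
  proof -
    have copies: "copies k y \<in> S" if "y \<notin> A" "setdist_e d y A < \<infinity>" for k y
      using S copies_in_Dfin[OF that(1), of k] copies_in_Dbar_p[OF d that, of k p] by blast
    have upper: "dcard (upper d A \<delta> \<alpha>) < \<infinity>" if "p = \<infinity>" "\<alpha> \<in> S" "\<delta> > 0" for \<alpha> \<delta>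
    proof (cases "S = Dfin A")
      case True
      then show ?thesis using Dfin_dcard_upper that(2) by blast
    next
      case False
      then have "\<alpha> \<in> Dbar_p d A \<infinity>" using S that by blast
      then show ?thesis using that(3) by (simp add: Dbar_p_def)
    qed
    have lower: "dsum (\<lambda>a. epowr (if setdist_e d a A = \<infinity> then 0 else setdist_e d a A) (enn2real p)) \<alpha> < \<infinity>"
      if "p \<noteq> \<infinity>" "\<alpha> \<in> S" for \<alpha>
    proof (cases "S = Dfin A")
      case True
      then show ?thesis using Dfin_sum_finite that(2) by blast
    next
      case False
      then have "\<alpha> \<in> Dbar_p d A p" using S that by blast
      then have "Wp d A p (lower d A \<infinity> \<alpha>) zero_diag < \<infinity>" using that(1) by (simp add: Dbar_p_def)
      then show ?thesis by (rule lower_sum_finite[OF d assms(4) that(1)])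
    qed
    have zero: "zero_diag \<in> S" using copies[OF x, of 0] by (simp add: copies_0)
    show ?thesis
    proof (rule not_metrizable_compact_open[OF assms(3) zero])
      fix K and \<epsilon> :: real
      assume K: "compactin (ext_metric_topology S (Wp d A p)) K" and \<epsilon>: "\<epsilon> > 0"
      show "\<exists>z\<in>S. \<exists>F M. Wp d A p zero_diag z < ennreal \<epsilon>
          \<and> continuous_map (ext_metric_topology S (Wp d A p)) euclideanreal F
          \<and> (\<forall>k\<in>K. F k \<le> M) \<and> M < F z"
      proof (cases "p = \<infinity>")
        case True
        show ?thesis
          unfolding True
          by (rule separation_infinity[OF assms(1,2) copies upper[OF True] K[unfolded True] \<epsilon>])
      next
        case False
        show ?thesis
          by (rule separation_finite[OF assms(1,2,4) False copies lower[OF False] K \<epsilon>])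
      qed
    qed
  qed
  then show ?thesis by simp
qed

end
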